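(* Let $F\in\bar S=K_{\mathsf{dp}}[x_0,\ldots,x_n]$ be a homogeneous polynomial of degree $d$, and let $f=F(1,x_1,\ldots,x_n)\in S=K_{\mathsf{dp}}[x_1,\ldots,x_n]$. Let $\Gamma\subset\mathbb{P}(\bar S_1)$ be a zero-dimensional scheme of minimal length among local schemes supported at $[1:0:\cdots:0]$ that are apolar to $F$. Then $\Gamma$ is the affine apolar scheme of a polynomial $g\in S$ whose degree-$d$ tail equals $f$.
   Context: $K$ is an algebraically closed field of characteristic other than $2,3$. $\bar S=K_{\mathsf{dp}}[x_0,\ldots,x_n]$ and $S=K_{\mathsf{dp}}[x_1,\ldots,x_n]$ are divided power rings; $x^\beta$ denotes the divided power monomial $x_0^{[\beta_0]}\cdots x_n^{[\beta_n]}$, so that $x^\alpha\cdot x^\beta=\binom{\alpha+\beta}{\alpha}x^{\alpha+\beta}$. The polynomial ring $\bar T=K[y_0,\ldots,y_n]$ acts on $\bar S$ by contraction: $y^\alpha(x^\beta)=x^{\beta-\alpha}$ if $\beta\geq\alpha$ componentwise and $0$ otherwise; likewise $T=K[y_1,\ldots,y_n]$ acts on $S$. $F(1,x_1,\ldots,x_n)$ denotes the image of $F$ under the $K$-linear map sending $x_0^{\alpha_0}x_1^{\alpha_1}\cdots x_n^{\alpha_n}$ to $x_1^{\alpha_1}\cdots x_n^{\alpha_n}$ (divided power monomials). $\bar T$ is the homogeneous coordinate ring of $\mathbb{P}(\bar S_1)$; here $[1:0:\cdots:0]=[x_0]$. A subscheme $Z\subset\mathbb{P}(\bar S_1)$ is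 apolar to $F$ if its homogeneous (saturated) ideal $I_Z\subset\bar T$ is contained in $F^\perp=\{\Psi\in\bar T:\Psi(F)=0\}$. A local scheme is a zero-dimensional scheme supported at one point. The affine apolar scheme of $g\in S$ is $\operatorname{Spec}(T/g^\perp)\subset\operatorname{Spec}T$, where $g^\perp=\{\psi\in T:\psi(g)=0\}$ and $\operatorname{Spec} T$ is identified with the chart $\{y_0\neq 0\}$ of $\mathbb{P}(\bar S_1)$ (setting $y_0=1$). The degree-$d$ tail of $g$ is the sum of its homogeneous terms of degree at most $d$. *)

theory Defs
  imports
    "HOL-Library.Poly_Mapping"
    "HOL-Computational_Algebra.Computational_Algebra"
    "HOL-Algebra.QuotRing"
    "HOL-Algebra.Embedded_Algebras"
begin

section \<open>Polynomial rings, divided power rings and contraction\<close>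

text \<open>
  Exponent vectors are finitely supported maps from variable indices to naturals.  The
  type \<open>mpoly\<close> carries two products: the product of the type class instance is the
  convolution product of the ordinary polynomial ring, whereas \<open>dp_times\<close> is the divided power
  product.  A variable set \<open>V\<close> is \<open>{0..n}\<close> for the rings \<open>K[y\<^sub>0,\<dots>,y\<^sub>n]\<close> and
  \<open>K\<^sub>d\<^sub>p[x\<^sub>0,\<dots>,x\<^sub>n]\<close>, and \<open>{1..n}\<close> for \<open>K[y\<^sub>1,\<dots>,y\<^sub>n]\<close> and \<open>K\<^sub>d\<^sub>p[x\<^sub>1,\<dots>,x\<^sub>n]\<close>.
\<close>

type_synonym expo = "nat \<Rightarrow>\<^sub>0 nat"
type_synonym 'k mpoly = "expo \<Rightarrow>\<^sub>0 'k"

abbreviation mmonom :: "expo \<Rightarrow> 'k::zero \<Rightarrow> 'k mpoly"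
  where "mmonom \<equiv> Poly_Mapping.single"

abbreviation const :: "'k::zero \<Rightarrow> 'k mpoly"
  where "const c \<equiv> mmonom 0 c"

abbreviation Y :: "nat \<Rightarrow> 'k::zero_neq_one mpoly"
  where "Y i \<equiv> mmonom (Poly_Mapping.single i 1) 1"

definition polys_in :: "nat set \<Rightarrow> 'k::zero mpoly set"
  where "polys_in V = {p. \<forall>\<alpha>\<in>Poly_Mapping.keys p. Poly_Mapping.keys \<alpha> \<subseteq> V}"

definition mpoly_ring :: "nat set \<Rightarrow> 'k::field mpoly ring"
  where "mpoly_ring V =
    \<lparr>carrier = polys_in V, mult = (*), one = 1, zero = 0, add = (+)\<rparr>"

definition multibinom :: "expo \<Rightarrow> expo \<Rightarrow> nat"
  where "multibinom \<gamma> \<alpha> = (\<Prod>i\<in>Poly_Mapping.keys \<gamma>. Poly_Mapping.lookup \<gamma> i choose Poly_Mapping.lookup \<alpha> i)"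

definition dp_times :: "'k::field mpoly \<Rightarrow> 'k mpoly \<Rightarrow> 'k mpoly"
  where "dp_times p q =
    (\<Sum>\<alpha>\<in>Poly_Mapping.keys p. \<Sum>\<beta>\<in>Poly_Mapping.keys q.
       mmonom (\<alpha> + \<beta>) (of_nat (multibinom (\<alpha> + \<beta>) \<alpha>) * Poly_Mapping.lookup p \<alpha> * Poly_Mapping.lookup q \<beta>))"

definition dp_ring :: "nat set \<Rightarrow> 'k::field mpoly ring"
  where "dp_ring V =
    \<lparr>carrier = polys_in V, mult = dp_times, one = 1, zero = 0, add = (+)\<rparr>"

text \<open>
  The order instance of \<^typ>\<open>expo\<close> is lexicographic, so the componentwise order is spelled out.
\<close>

definition contract :: "'k::field mpoly \<Rightarrow> 'k mpoly \<Rightarrow> 'k mpoly"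
  where "contract \<psi> F =
    (\<Sum>\<alpha>\<in>Poly_Mapping.keys \<psi>. \<Sum>\<beta>\<in>Poly_Mapping.keys F.
       if \<forall>i. Poly_Mapping.lookup \<alpha> i \<le> Poly_Mapping.lookup \<beta> i
       then mmonom (\<beta> - \<alpha>) (Poly_Mapping.lookup \<psi> \<alpha> * Poly_Mapping.lookup F \<beta>) else 0)"

definition perp :: "nat set \<Rightarrow> 'k::field mpoly \<Rightarrow> 'k mpoly set"
  where "perp V F = {\<psi> \<in> carrier (mpoly_ring V). contract \<psi> F = 0}"

lemma dp_times_monomial:
  "dp_times (mmonom \<alpha> 1) (mmonom \<beta> 1) =
     mmonom (\<alpha> + \<beta>) (of_nat (multibinom (\<alpha> + \<beta>) \<alpha>) :: 'k::field)"
  by (simp add: dp_times_def)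

lemma contract_monomial:
  "contract (mmonom \<alpha> 1) (mmonom \<beta> (1 :: 'k::field)) =
     (if \<forall>i. Poly_Mapping.lookup \<alpha> i \<le> Poly_Mapping.lookup \<beta> i then mmonom (\<beta> - \<alpha>) 1 else 0)"
  by (auto simp: contract_def intro!: sum.neutral)

lemma cring_mpoly_ring: "cring (mpoly_ring V :: 'k::field mpoly ring)"
proof (rule cringI)
  show "abelian_group (mpoly_ring V :: 'k mpoly ring)"
  proof (rule abelian_groupI)
    fix p :: "'k mpoly" assume "p \<in> carrier (mpoly_ring V)"
    then show "\<exists>q\<in>carrier (mpoly_ring V). q \<oplus>\<^bsub>mpoly_ring V\<^esub> p = \<zero>\<^bsub>mpoly_ring V\<^esub>"
      by (intro bexI[of _ "- p"]) (auto simp: mpoly_ring_def polys_in_def in_keys_iff)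
  next
    fix p q :: "'k mpoly" assume "p \<in> carrier (mpoly_ring V)" "q \<in> carrier (mpoly_ring V)"
    then show "p \<oplus>\<^bsub>mpoly_ring V\<^esub> q \<in> carrier (mpoly_ring V)"
      using keys_add[of p q] by (fastforce simp: mpoly_ring_def polys_in_def)
  qed (auto simp: mpoly_ring_def polys_in_def add_ac)
next
  show "Group.comm_monoid (mpoly_ring V :: 'k mpoly ring)"
  proof (rule comm_monoidI)
    fix p q :: "'k mpoly" assume pq: "p \<in> carrier (mpoly_ring V)" "q \<in> carrier (mpoly_ring V)"
    show "p \<otimes>\<^bsub>mpoly_ring V\<^esub> q \<in> carrier (mpoly_ring V)"
    proof (simp add: mpoly_ring_def polys_in_def, intro ballI)
      fix \<gamma> assume "\<gamma> \<in> Poly_Mapping.keys (p * q)"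
      then obtain \<alpha> \<beta> where "\<gamma> = \<alpha> + \<beta>"
        "\<alpha> \<in> Poly_Mapping.keys p" "\<beta> \<in> Poly_Mapping.keys q"
        using keys_mult[of p q] by blast
      then show "Poly_Mapping.keys \<gamma> \<subseteq> V"
        using pq keys_add[of \<alpha> \<beta>] by (fastforce simp: mpoly_ring_def polys_in_def)
    qed
  qed (auto simp: mpoly_ring_def polys_in_def mult_ac)
qed (auto simp: mpoly_ring_def algebra_simps)


section \<open>Degrees and dehomogenisation\<close>

definition mdeg :: "expo \<Rightarrow> nat"
  where "mdeg \<alpha> = (\<Sum>i\<in>Poly_Mapping.keys \<alpha>. Poly_Mapping.lookup \<alpha> i)"

definition homogeneous :: "nat \<Rightarrow> 'k::field mpoly \<Rightarrow> bool"
  where "homogeneous d p \<longleftrightarrow> (\<forall>\<alpha>\<in>Poly_Mapping.keys p. mdeg \<alpha> = d)"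

definition hom_component :: "nat \<Rightarrow> 'k::field mpoly \<Rightarrow> 'k mpoly"
  where "hom_component e p =
    (\<Sum>\<alpha> \<in> {\<alpha> \<in> Poly_Mapping.keys p. mdeg \<alpha> = e}. mmonom \<alpha> (Poly_Mapping.lookup p \<alpha>))"

definition tail :: "nat \<Rightarrow> 'k::field mpoly \<Rightarrow> 'k mpoly"
  where "tail d p = (\<Sum>e\<le>d. hom_component e p)"

text \<open>
  The linear map that erases the exponent of the variable with index 0 from every mmonom.  On
  divided power polynomials it is \<open>F \<mapsto> F(1,x\<^sub>1,\<dots>,x\<^sub>n)\<close>; on \<open>K[y\<^sub>0,\<dots>,y\<^sub>n]\<close> it is the
  ring homomorphism \<open>y\<^sub>0 \<mapsto> 1\<close>.
\<close>

definition dehom :: "'k::field mpoly \<Rightarrow> 'k mpoly"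
  where "dehom p =
    (\<Sum>\<alpha>\<in>Poly_Mapping.keys p. mmonom (Poly_Mapping.update 0 0 \<alpha>) (Poly_Mapping.lookup p \<alpha>))"


section \<open>Closed subschemes of projective space\<close>

text \<open>
  A closed subscheme of \<open>\<P>\<^sup>n = Proj K[y\<^sub>0,\<dots>,y\<^sub>n]\<close> is represented by its saturated
  homogeneous ideal, and its points are the homogeneous primes that contain this ideal
  but not the irrelevant ideal.
\<close>

definition homogeneous_ideal :: "nat \<Rightarrow> 'k::field mpoly set \<Rightarrow> bool"
  where "homogeneous_ideal n I \<longleftrightarrow>
    ideal I (mpoly_ring {0..n}) \<and> (\<forall>p\<in>I. \<forall>e. hom_component e p \<in> I)"

definition saturated :: "nat \<Rightarrow> 'k::field mpoly set \<Rightarrow> bool"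
  where "saturated n I \<longleftrightarrow>
    (\<forall>p\<in>carrier (mpoly_ring {0..n}). (\<forall>i\<le>n. \<exists>k. Y i ^ k * p \<in> I) \<longrightarrow> p \<in> I)"

definition closed_subscheme :: "nat \<Rightarrow> 'k::field mpoly set \<Rightarrow> bool"
  where "closed_subscheme n Z \<longleftrightarrow> homogeneous_ideal n Z \<and> saturated n Z"

definition proj_points :: "nat \<Rightarrow> 'k::field mpoly set set"
  where "proj_points n =
    {P. homogeneous_ideal n P \<and> primeideal P (mpoly_ring {0..n}) \<and> \<not> Y ` {0..n} \<subseteq> P}"

definition support :: "nat \<Rightarrow> 'k::field mpoly set \<Rightarrow> 'k mpoly set set"
  where "support n Z = {P \<in> proj_points n. Z \<subseteq> P}"

text \<open>Krull dimension zero: nonempty, and no point specialises to another one.\<close>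

definition zero_dimensional :: "nat \<Rightarrow> 'k::field mpoly set \<Rightarrow> bool"
  where "zero_dimensional n Z \<longleftrightarrow>
    support n Z \<noteq> {} \<and> (\<forall>P\<in>support n Z. \<forall>Q\<in>support n Z. P \<subseteq> Q \<longrightarrow> P = Q)"

text \<open>The point \<open>[1:0:\<dots>:0]\<close>, i.e. the homogeneous prime \<open>(y\<^sub>1,\<dots>,y\<^sub>n)\<close>.\<close>

definition point_x0 :: "nat \<Rightarrow> 'k::field mpoly set"
  where "point_x0 n = genideal (mpoly_ring {0..n}) (Y ` {1..n})"

definition local_scheme_at :: "nat \<Rightarrow> 'k::field mpoly set \<Rightarrow> 'k mpoly set \<Rightarrow> bool"
  where "local_scheme_at n P Z \<longleftrightarrow>
    closed_subscheme n Z \<and> zero_dimensional n Z \<and> support n Z = {P}"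

definition apolar :: "nat \<Rightarrow> 'k::field mpoly \<Rightarrow> 'k mpoly set \<Rightarrow> bool"
  where "apolar n F Z \<longleftrightarrow> Z \<subseteq> perp {0..n} F"


section \<open>The chart where the first coordinate does not vanish\<close>

text \<open>
  Setting \<open>y\<^sub>0 = 1\<close> identifies the chart with \<open>Spec K[y\<^sub>1,\<dots>,y\<^sub>n]\<close>; the part of \<open>Z\<close> in the
  chart is the closed subscheme cut out by the ideal \<open>chart_ideal Z\<close>.
\<close>

definition chart_ideal :: "'k::field mpoly set \<Rightarrow> 'k mpoly set"
  where "chart_ideal Z = dehom ` Z"

definition in_chart :: "nat \<Rightarrow> 'k::field mpoly set \<Rightarrow> bool"
  where "in_chart n Z \<longleftrightarrow> (\<forall>P\<in>support n Z. Y 0 \<notin> P)"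

text \<open>
  The length of a zero-dimensional scheme contained in the chart: the dimension over \<open>K\<close> of
  its ring of global functions, with \<open>K\<close> embedded in this quotient ring as the constants.
  Schemes supported at \<open>[1:0:\<dots>:0]\<close> lie in the chart.
\<close>

definition chart_length :: "nat \<Rightarrow> 'k::field mpoly set \<Rightarrow> nat"
  where "chart_length n Z =
    (let T = mpoly_ring {1..n}; J = chart_ideal Z in
     ring.dim (T Quot J) (range (\<lambda>c. J +>\<^bsub>T\<^esub> const c)) (carrier (T Quot J)))"

text \<open>\<open>Z\<close> is \<open>Spec (T / g\<^sup>\<bottom>)\<close>, viewed in projective space through the chart.\<close>

definition is_affine_apolar_scheme :: "nat \<Rightarrow> 'k::field mpoly set \<Rightarrow> 'k mpoly \<Rightarrow> bool"
  where "is_affine_apolar_scheme n Z g \<longleftrightarrow>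
    in_chart n Z \<and> chart_ideal Z = perp {1..n} g"

end

theory Submission
  imports Defs
begin

text \<open>
  Write \<open>T = K[y\<^sub>1,\<dots>,y\<^sub>n]\<close>, let \<open>I\<close> be the saturated homogeneous ideal of \<open>\<Gamma>\<close> and
  \<open>J \<subseteq> T\<close> the ideal obtained from it by setting \<open>y\<^sub>0 = 1\<close>.  The argument is linear duality.

  Since \<open>[1:0:\<dots>:0]\<close> is the only point of \<open>\<Gamma>\<close>, every \<open>y\<^sub>i\<close> with \<open>i \<ge> 1\<close> has a power in
  \<open>I\<close> (\<open>nilpotent_of_support\<close>: otherwise some homogeneous prime over \<open>I\<close> would avoid \<open>y\<^sub>i\<close>).
  Hence \<open>J\<close> contains all monomials outside a finite set, and as \<open>I\<close> is saturated,
  factors \<open>y\<^sub>0\<close> can be cancelled modulo \<open>I\<close>.  So every \<open>\<psi> \<in> J\<close> of degree at most \<open>d\<close>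
  homogenises to an element of \<open>I\<close> of degree exactly \<open>d\<close> (\<open>homogenize_mem\<close>).  Applied to
  \<open>F\<close> this element yields a constant, namely \<open>\<Sum>\<alpha>. \<psi>\<^sub>\<alpha> f\<^sub>\<alpha>\<close>, and apolarity says that it
  vanishes.  In other words, the functional \<open>\<psi> \<mapsto> \<Sum>\<alpha>. \<psi>\<^sub>\<alpha> f\<^sub>\<alpha>\<close> on the polynomials of degree
  at most \<open>d\<close> is zero on \<open>J\<close>, so it extends to a functional on \<open>T\<close> that is zero on all of \<open>J\<close>.
  As \<open>J\<close> contains almost all monomials, the values of the extension on monomials are the
  coefficients of a polynomial \<open>g\<close>; its degree-\<open>d\<close> tail is \<open>f\<close>, and because \<open>J\<close> is an
  ideal, \<open>J \<subseteq> g\<^sup>\<bottom>\<close> (\<open>dual_generator_exists\<close>).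

  It remains to see that \<open>J = g\<^sup>\<bottom>\<close>.  The projective closure of \<open>Spec (T/g\<^sup>\<bottom>)\<close> is again a local
  scheme at \<open>[1:0:\<dots>:0]\<close>, and it is apolar to \<open>F\<close> because the tail of \<open>g\<close> is \<open>f\<close>
  (\<open>projective_closure_perp_apolar\<close>).  If \<open>J\<close> were strictly smaller than \<open>g\<^sup>\<bottom>\<close>, then
  \<open>T/g\<^sup>\<bottom>\<close> would have smaller dimension than \<open>T/J\<close> (\<open>dim_quotient_less\<close>), against the
  minimality of \<open>\<Gamma>\<close>.
\<close>

abbreviation (input) lookup :: "('a \<Rightarrow>\<^sub>0 'b::zero) \<Rightarrow> 'a \<Rightarrow> 'b"
  where "lookup \<equiv> Poly_Mapping.lookup"

abbreviation (input) keys :: "('a \<Rightarrow>\<^sub>0 'b::zero) \<Rightarrow> 'a set"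
  where "keys \<equiv> Poly_Mapping.keys"

section \<open>Linear forms on polynomials\<close>

text \<open>
  The linear functional on polynomials with value \<open>h \<alpha>\<close> on the monomial \<open>y\<^sup>\<alpha>\<close>.  These functionals
  separate polynomials, and products, contraction, dehomogenisation and homogenisation all
  translate into a substitution in \<open>h\<close>; identities between these operations thereby reduce
  to identities between exponents.
\<close>

definition linear_form :: "(expo \<Rightarrow> 'k::field) \<Rightarrow> 'k mpoly \<Rightarrow> 'k"
  where "linear_form h p = (\<Sum>\<alpha>\<in>keys p. lookup p \<alpha> * h \<alpha>)"

lemma linear_form_superset:
  assumes "finite A" "keys p \<subseteq> A"
  shows "linear_form h p = (\<Sum>\<alpha>\<in>A. lookup p \<alpha> * h \<alpha>)"
  unfolding linear_form_def by (rule sum.mono_neutral_left) (use assms in \<open>auto simp: in_keys_iff\<close>)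

lemma linear_form_zero [simp]: "linear_form h 0 = 0"
  by (simp add: linear_form_def)

lemma linear_form_monomial [simp]: "linear_form h (mmonom \<alpha> c) = c * h \<alpha>"
  by (simp add: linear_form_def)

lemma linear_form_add: "linear_form h (p + q) = linear_form h p + linear_form h q"
proof -
  let ?A = "keys p \<union> keys q"
  have "linear_form h r = (\<Sum>\<alpha>\<in>?A. lookup r \<alpha> * h \<alpha>)" if "keys r \<subseteq> ?A" for r
    using that by (intro linear_form_superset) auto
  then show ?thesis
    using keys_add[of p q] by (simp add: lookup_add distrib_right sum.distrib)
qed

lemma linear_form_sum: "linear_form h (\<Sum>i\<in>A. p i) = (\<Sum>i\<in>A. linear_form h (p i))"
  by (induction A rule: infinite_finite_induct) (auto simp: linear_form_add)

lemma linear_form_scale_left: "linear_form (\<lambda>\<alpha>. c * h \<alpha>) p = c * linear_form h p"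
  by (simp add: linear_form_def sum_distrib_left mult_ac)

lemma linear_form_cong:
  assumes "\<And>\<alpha>. \<alpha> \<in> keys p \<Longrightarrow> h \<alpha> = k \<alpha>"
  shows "linear_form h p = linear_form k p"
  unfolding linear_form_def by (intro sum.cong) (auto simp: assms)

lemma linear_form_eq_0I:
  assumes "\<And>\<alpha>. \<alpha> \<in> keys p \<Longrightarrow> h \<alpha> = 0"
  shows "linear_form h p = 0"
  unfolding linear_form_def by (intro sum.neutral) (auto simp: assms)

lemma lookup_eq_linear_form: "lookup p \<gamma> = linear_form (\<lambda>\<alpha>. if \<alpha> = \<gamma> then 1 else 0) p"
proof -
  have "linear_form (\<lambda>\<alpha>. if \<alpha> = \<gamma> then 1 else 0) p
      = (\<Sum>\<alpha>\<in>keys p. if \<alpha> = \<gamma> then lookup p \<alpha> else 0)"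
    unfolding linear_form_def by (intro sum.cong) auto
  then show ?thesis
    by (simp add: in_keys_iff)
qed

lemma poly_eqI_linear_form:
  assumes "\<And>h. linear_form h p = linear_form h q"
  shows "p = q"
  by (rule poly_mapping_eqI) (simp add: lookup_eq_linear_form assms)

lemma sum_monomials: "(p :: 'k::field mpoly) = (\<Sum>\<alpha>\<in>keys p. mmonom \<alpha> (lookup p \<alpha>))"
  by (rule poly_eqI_linear_form) (simp add: linear_form_sum, simp add: linear_form_def)

lemma mpoly_induct [case_names zero monomial add]:
  fixes p :: "'k::field mpoly"
  assumes "P 0" "\<And>\<alpha> c. P (mmonom \<alpha> c)" "\<And>p q. P p \<Longrightarrow> P q \<Longrightarrow> P (p + q)"
  shows "P p"
proof -
  have "P (\<Sum>\<alpha>\<in>A. mmonom \<alpha> (lookup p \<alpha>))" for A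
    by (induction A rule: infinite_finite_induct) (auto intro: assms)
  then show ?thesis
    by (subst sum_monomials)
qed

lemma linear_form_mult:
  "linear_form h (p * q) = linear_form (\<lambda>\<alpha>. linear_form (\<lambda>\<beta>. h (\<alpha> + \<beta>)) q) p"
proof (induction p rule: mpoly_induct)
  case (monomial \<alpha> c)
  show ?case
    by (induction q rule: mpoly_induct)
      (simp_all add: mult_single linear_form_add distrib_left mult.assoc)
qed (auto simp: linear_form_add distrib_right)

lemma linear_form_monomial_mult:
  "linear_form h (mmonom \<alpha> c * q) = c * linear_form (\<lambda>\<beta>. h (\<alpha> + \<beta>)) q"
  by (simp add: linear_form_mult)

section \<open>Contraction\<close>

text \<open>
  The conditions \<open>\<alpha> \<le> \<beta>\<close> and \<open>\<beta> - \<alpha> = \<gamma>\<close> together say that \<open>\<beta> = \<alpha> + \<gamma>\<close>.  So each coefficient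
  of \<open>\<psi>(F)\<close> is a linear form in \<open>\<psi>\<close>, and annihilating \<open>F\<close> is a family of linear conditions.
\<close>

lemma lookup_contract: "lookup (contract \<psi> F) \<gamma> = linear_form (\<lambda>\<alpha>. lookup F (\<alpha> + \<gamma>)) \<psi>"
proof -
  have *: "lookup (if \<forall>i. lookup \<alpha> i \<le> lookup \<beta> i
        then mmonom (\<beta> - \<alpha>) (lookup \<psi> \<alpha> * lookup F \<beta>) else 0) \<gamma>
      = (if \<beta> = \<alpha> + \<gamma> then lookup \<psi> \<alpha> * lookup F \<beta> else 0)" for \<alpha> \<beta> :: expo
  proof -
    have "(\<forall>i. lookup \<alpha> i \<le> lookup \<beta> i) \<and> \<beta> - \<alpha> = \<gamma> \<longleftrightarrow> \<beta> = \<alpha> + \<gamma>"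
      by (auto simp: poly_mapping_eq_iff fun_eq_iff lookup_add lookup_minus)
        (metis le_add_diff_inverse)
    then show ?thesis
      by (auto simp: lookup_single when_def)
  qed
  show ?thesis
    unfolding contract_def lookup_sum * linear_form_def
    by (intro sum.cong refl) (auto simp: in_keys_iff)
qed

lemma contract_eq_0_iff:
  "contract \<psi> F = 0 \<longleftrightarrow> (\<forall>\<gamma>. linear_form (\<lambda>\<alpha>. lookup F (\<alpha> + \<gamma>)) \<psi> = 0)"
  by (simp add: poly_mapping_eq_iff fun_eq_iff lookup_contract)

lemma perp_iff:
  "\<psi> \<in> perp V F \<longleftrightarrow>
     \<psi> \<in> polys_in V \<and> (\<forall>\<gamma>. linear_form (\<lambda>\<alpha>. lookup F (\<alpha> + \<gamma>)) \<psi> = 0)"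
  by (simp add: perp_def mpoly_ring_def contract_eq_0_iff)

section \<open>Ideals of polynomials\<close>

lemma mpoly_ring_simps [simp]:
  "carrier (mpoly_ring V) = polys_in V" "p \<otimes>\<^bsub>mpoly_ring V\<^esub> q = p * q"
  "\<one>\<^bsub>mpoly_ring V\<^esub> = 1" "\<zero>\<^bsub>mpoly_ring V\<^esub> = 0" "p \<oplus>\<^bsub>mpoly_ring V\<^esub> q = p + q"
  by (simp_all add: mpoly_ring_def)

lemma polys_in_monomial: "keys \<alpha> \<subseteq> V \<Longrightarrow> mmonom \<alpha> c \<in> polys_in V"
  by (simp add: polys_in_def)

lemma polys_in_add: "p \<in> polys_in V \<Longrightarrow> q \<in> polys_in V \<Longrightarrow> p + q \<in> polys_in V"
  using keys_add[of p q] by (fastforce simp: polys_in_def)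

lemma polys_in_mult: "p \<in> polys_in V \<Longrightarrow> q \<in> polys_in V \<Longrightarrow> p * q \<in> (polys_in V :: 'k::field mpoly set)"
proof -
  interpret cring "mpoly_ring V :: 'k mpoly ring"
    by (rule cring_mpoly_ring)
  show "p \<in> polys_in V \<Longrightarrow> q \<in> polys_in V \<Longrightarrow> p * q \<in> polys_in V"
    using m_closed[of p q] by simp
qed

lemma polys_in_simps [simp]: "0 \<in> polys_in V" "1 \<in> polys_in V" "const c \<in> polys_in V"
  by (simp_all add: polys_in_def)

lemma polys_in_sum: "(\<And>i. i \<in> A \<Longrightarrow> p i \<in> polys_in V) \<Longrightarrow> (\<Sum>i\<in>A. p i) \<in> polys_in V"
  by (induction A rule: infinite_finite_induct) (auto intro: polys_in_add)

lemma polys_in_Y: "i \<in> V \<Longrightarrow> Y i \<in> polys_in V"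
  by (simp add: polys_in_monomial)

lemma Y_power: "Y i ^ k = (mmonom (Poly_Mapping.single i k) 1 :: 'k::field mpoly)"
  by (induction k) (simp_all add: mult_single flip: single_add)

lemma polys_in_Y_power: "i \<in> V \<Longrightarrow> Y i ^ k \<in> (polys_in V :: 'k::field mpoly set)"
  unfolding Y_power by (simp add: polys_in_monomial)

lemma idealI_mpoly:
  fixes I :: "'k::field mpoly set"
  assumes "I \<subseteq> polys_in V" "0 \<in> I" "\<And>p q. p \<in> I \<Longrightarrow> q \<in> I \<Longrightarrow> p + q \<in> I"
    and mult: "\<And>p q. p \<in> I \<Longrightarrow> q \<in> polys_in V \<Longrightarrow> q * p \<in> I"
  shows "ideal I (mpoly_ring V)"
proof -
  interpret R: cring "mpoly_ring V :: 'k mpoly ring"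
    by (rule cring_mpoly_ring)
  show ?thesis
  proof (rule idealI)
    show "subgroup I (add_monoid (mpoly_ring V))"
    proof (rule R.add.subgroupI)
      fix p assume p: "p \<in> I"
      have "\<ominus>\<^bsub>mpoly_ring V\<^esub> p = const (-1) * p"
      proof (rule R.minus_equality)
        show "const (-1) * p \<oplus>\<^bsub>mpoly_ring V\<^esub> p = \<zero>\<^bsub>mpoly_ring V\<^esub>"
          by (simp add: single_uminus)
        show "p \<in> carrier (mpoly_ring V)" "const (-1) * p \<in> carrier (mpoly_ring V)"
          using p assms(1) by (auto intro: polys_in_mult)
      qed
      then show "\<ominus>\<^bsub>mpoly_ring V\<^esub> p \<in> I"
        using mult[OF p, of "const (-1)"] by simp
    qed (use assms in auto)
  next
    show "ring (mpoly_ring V :: 'k mpoly ring)" by (rule R.ring_axioms)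
  qed (use assms in \<open>auto simp: mult.commute\<close>)
qed

context
  fixes I :: "'k::field mpoly set" and V
  assumes I: "ideal I (mpoly_ring V)"
begin

lemma ideal_subset: "p \<in> I \<Longrightarrow> p \<in> polys_in V"
  using additive_subgroup.a_subset[OF ideal.axioms(1)[OF I]] by auto

lemma ideal_zero: "0 \<in> I"
  using additive_subgroup.zero_closed[OF ideal.axioms(1)[OF I]] by simp

lemma ideal_add: "p \<in> I \<Longrightarrow> q \<in> I \<Longrightarrow> p + q \<in> I"
  using additive_subgroup.a_closed[OF ideal.axioms(1)[OF I]] by simp

lemma ideal_mult: "p \<in> I \<Longrightarrow> q \<in> polys_in V \<Longrightarrow> q * p \<in> I"
  using ideal.I_l_closed[OF I] by simp

lemma ideal_diff: "p \<in> I \<Longrightarrow> q \<in> I \<Longrightarrow> p - q \<in> I"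
proof -
  assume "p \<in> I" "q \<in> I"
  then have "p + const (-1) * q \<in> I"
    by (intro ideal_add ideal_mult) simp_all
  then show ?thesis
    by (simp add: single_uminus)
qed

lemma ideal_sum: "(\<And>i. i \<in> A \<Longrightarrow> p i \<in> I) \<Longrightarrow> (\<Sum>i\<in>A. p i) \<in> I"
  by (induction A rule: infinite_finite_induct) (auto intro: ideal_add ideal_zero)

end

text \<open>
  Multiplying \<open>\<psi>\<close> by \<open>y\<^sup>\<alpha>\<close> turns the condition for \<open>\<gamma>\<close> into the one for \<open>\<alpha> + \<gamma>\<close>.
\<close>

lemma ideal_perp:
  fixes F :: "'k::field mpoly"
  shows "ideal (perp V F) (mpoly_ring V)"
proof (rule idealI_mpoly)
  fix p q :: "'k mpoly" assume p: "p \<in> perp V F" and q: "q \<in> polys_in V"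
  have "linear_form (\<lambda>\<beta>. lookup F (\<alpha> + \<beta> + \<gamma>)) p = 0" for \<alpha> \<gamma>
  proof -
    have "\<alpha> + \<beta> + \<gamma> = \<beta> + (\<alpha> + \<gamma>)" for \<beta>
      by (simp add: add_ac)
    then show ?thesis
      using p by (simp add: perp_iff)
  qed
  then show "q * p \<in> perp V F"
    using p q by (simp add: perp_iff polys_in_mult linear_form_mult linear_form_eq_0I)
qed (auto simp: perp_iff polys_in_add linear_form_add)

section \<open>Degrees and homogeneous components\<close>

lemma mdeg_superset:
  assumes "finite A" "keys \<alpha> \<subseteq> A"
  shows "mdeg \<alpha> = (\<Sum>i\<in>A. lookup \<alpha> i)"
  unfolding mdeg_def by (rule sum.mono_neutral_left) (use assms in \<open>auto simp: in_keys_iff\<close>)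

lemma mdeg_add [simp]: "mdeg (\<alpha> + \<beta>) = mdeg \<alpha> + mdeg \<beta>"
proof -
  let ?A = "keys \<alpha> \<union> keys \<beta>"
  have "mdeg \<gamma> = (\<Sum>i\<in>?A. lookup \<gamma> i)" if "keys \<gamma> \<subseteq> ?A" for \<gamma>
    using that by (intro mdeg_superset) auto
  then show ?thesis
    using keys_add[of \<alpha> \<beta>] by (simp add: lookup_add sum.distrib)
qed

lemma mdeg_single [simp]: "mdeg (Poly_Mapping.single i k) = k"
  by (simp add: mdeg_def)

lemma lookup_hom_component:
  "lookup (hom_component e p) \<alpha> = (if mdeg \<alpha> = e then lookup p \<alpha> else 0)"
proof -
  have "lookup (hom_component e p) \<alpha>
      = (\<Sum>\<beta> | \<beta> \<in> keys p \<and> mdeg \<beta> = e. if \<beta> = \<alpha> then lookup p \<beta> else 0)"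
    unfolding hom_component_def lookup_sum by (intro sum.cong) (auto simp: lookup_single when_def)
  then show ?thesis
    by (simp add: sum.delta in_keys_iff)
qed

lemma lookup_tail: "lookup (tail d p) \<alpha> = (if mdeg \<alpha> \<le> d then lookup p \<alpha> else 0)"
  by (simp add: tail_def lookup_sum lookup_hom_component)

lemma keys_hom_component: "keys (hom_component e p) = {\<alpha> \<in> keys p. mdeg \<alpha> = e}"
  by (auto simp: in_keys_iff lookup_hom_component split: if_splits)

lemma hom_component_zero [simp]: "hom_component e 0 = 0"
  by (simp add: hom_component_def)

lemma hom_component_add: "hom_component e (p + q) = hom_component e p + hom_component e q"
  by (rule poly_mapping_eqI) (simp add: lookup_hom_component lookup_add)

lemma hom_component_sum: "hom_component e (\<Sum>i\<in>A. p i) = (\<Sum>i\<in>A. hom_component e (p i))"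
  by (rule poly_mapping_eqI) (simp add: lookup_hom_component lookup_sum)

lemma hom_component_monomial:
  "hom_component e (mmonom \<alpha> c) = (if mdeg \<alpha> = e then mmonom \<alpha> c else 0)"
  by (rule poly_mapping_eqI) (auto simp: lookup_hom_component lookup_single when_def)

lemma hom_component_homogeneous:
  "homogeneous d p \<Longrightarrow> hom_component e p = (if e = d then p else 0)"
  by (rule poly_mapping_eqI) (auto simp: lookup_hom_component homogeneous_def in_keys_iff)

lemma homogeneous_hom_component: "homogeneous e (hom_component e p)"
  by (simp add: homogeneous_def keys_hom_component)

lemma polys_in_hom_component: "p \<in> polys_in V \<Longrightarrow> hom_component e p \<in> polys_in V"
  by (simp add: polys_in_def keys_hom_component)

lemma degree_bound:
  fixes p :: "'k::field mpoly"
  obtains N where "\<And>\<alpha>. \<alpha> \<in> keys p \<Longrightarrow> mdeg \<alpha> \<le> N"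
proof -
  have "finite (mdeg ` keys p)"
    by simp
  then show ?thesis
    using that by (auto simp: finite_nat_set_iff_bounded_le)
qed

lemma sum_hom_components:
  assumes "\<And>\<alpha>. \<alpha> \<in> keys p \<Longrightarrow> mdeg \<alpha> \<le> N"
  shows "(\<Sum>e\<le>N. hom_component e p) = p"
proof (rule poly_mapping_eqI)
  fix \<alpha> show "lookup (\<Sum>e\<le>N. hom_component e p) \<alpha> = lookup p \<alpha>"
    using assms[of \<alpha>] by (auto simp: lookup_sum lookup_hom_component in_keys_iff)
qed

lemma hom_component_mult:
  "hom_component k (p * q) = (\<Sum>i\<le>k. hom_component i p * hom_component (k - i) q)"
proof (induction p rule: mpoly_induct)
  case (monomial \<alpha> a)
  show ?case
  proof (induction q rule: mpoly_induct)
    case (monomial \<beta> b)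
    have "(\<Sum>i\<le>k. hom_component i (mmonom \<alpha> a) * hom_component (k - i) (mmonom \<beta> b))
        = (\<Sum>i\<le>k. if i = mdeg \<alpha> then mmonom \<alpha> a * hom_component (k - i) (mmonom \<beta> b) else 0)"
      by (intro sum.cong) (auto simp: hom_component_monomial)
    also have "\<dots> = hom_component k (mmonom \<alpha> a * mmonom \<beta> b)"
      by (auto simp: hom_component_monomial mult_single)
    finally show ?case ..
  qed (simp_all add: hom_component_add distrib_left sum.distrib)
qed (simp_all add: hom_component_add distrib_right sum.distrib)

section \<open>Dehomogenisation and homogenisation\<close>

abbreviation erase0 :: "expo \<Rightarrow> expo"
  where "erase0 \<equiv> Poly_Mapping.update 0 0"

lemma erase0_add [simp]: "erase0 (\<alpha> + \<beta>) = erase0 \<alpha> + erase0 \<beta>"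
  by (rule poly_mapping_eqI) (simp add: lookup_update lookup_add)

lemma erase0_single [simp]: "erase0 (Poly_Mapping.single i k) = (if i = 0 then 0 else Poly_Mapping.single i k)"
  by (rule poly_mapping_eqI) (auto simp: lookup_update lookup_single when_def)

lemma keys_erase0 [simp]: "keys (erase0 \<alpha>) = keys \<alpha> - {0}"
  by (simp add: keys_update)

lemma erase0_id: "0 \<notin> keys \<alpha> \<Longrightarrow> erase0 \<alpha> = \<alpha>"
  by (rule poly_mapping_eqI) (simp add: lookup_update in_keys_iff)

lemma erase0_split: "\<alpha> = erase0 \<alpha> + Poly_Mapping.single 0 (lookup \<alpha> 0)"
  by (rule poly_mapping_eqI) (simp add: lookup_update lookup_add lookup_single when_def)

lemma mdeg_erase0: "mdeg \<alpha> = mdeg (erase0 \<alpha>) + lookup \<alpha> 0"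
  using mdeg_add[of "erase0 \<alpha>" "Poly_Mapping.single 0 (lookup \<alpha> 0)"]
  by (simp flip: erase0_split)

lemma linear_form_dehom: "linear_form h (dehom p) = linear_form (\<lambda>\<alpha>. h (erase0 \<alpha>)) p"
  unfolding dehom_def linear_form_sum linear_form_monomial by (simp add: linear_form_def)

lemma dehom_zero [simp]: "dehom 0 = 0"
  by (simp add: dehom_def)

lemma dehom_monomial: "dehom (mmonom \<alpha> c) = mmonom (erase0 \<alpha>) c"
  by (rule poly_eqI_linear_form) (simp add: linear_form_dehom)

lemma dehom_add: "dehom (p + q) = dehom p + dehom q"
  by (rule poly_eqI_linear_form) (simp add: linear_form_dehom linear_form_add)

lemma dehom_sum: "dehom (\<Sum>i\<in>A. p i) = (\<Sum>i\<in>A. dehom (p i))"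
  by (rule poly_eqI_linear_form) (simp add: linear_form_dehom linear_form_sum)

lemma dehom_mult: "dehom (p * q) = dehom p * dehom q"
  by (rule poly_eqI_linear_form) (simp add: linear_form_dehom linear_form_mult)

lemma dehom_id:
  assumes "p \<in> polys_in {1..n}"
  shows "dehom p = p"
proof (rule poly_eqI_linear_form)
  fix h :: "expo \<Rightarrow> 'a"
  show "linear_form h (dehom p) = linear_form h p"
    unfolding linear_form_dehom
    by (rule linear_form_cong) (use assms in \<open>force simp: polys_in_def erase0_id\<close>)
qed

lemma dehom_in:
  assumes "p \<in> polys_in {0..n}"
  shows "dehom p \<in> polys_in {1..n}"
  unfolding dehom_def using assms
  by (intro polys_in_sum polys_in_monomial) (force simp: polys_in_def Suc_le_eq)

lemma keys_dehom: "keys (dehom p) \<subseteq> erase0 ` keys p"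
proof
  fix \<gamma> assume "\<gamma> \<in> keys (dehom p)"
  then have "linear_form (\<lambda>\<alpha>. if erase0 \<alpha> = \<gamma> then 1 else 0) p \<noteq> 0"
    by (simp add: in_keys_iff lookup_eq_linear_form linear_form_dehom)
  then show "\<gamma> \<in> erase0 ` keys p"
    using linear_form_eq_0I[of p "\<lambda>\<alpha>. if erase0 \<alpha> = \<gamma> then 1 else 0"]
    by (metis imageI)
qed

lemma mdeg_dehom_le:
  assumes "homogeneous d p" "\<gamma> \<in> keys (dehom p)"
  shows "mdeg \<gamma> \<le> d"
proof -
  obtain \<alpha> where "\<alpha> \<in> keys p" "\<gamma> = erase0 \<alpha>"
    using assms(2) keys_dehom by blast
  then show ?thesis
    using assms(1) mdeg_erase0[of \<alpha>] by (simp add: homogeneous_def)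
qed

text \<open>
  In a fixed degree the exponent of the variable with index 0 is determined by the other
  exponents, so setting that variable to 1 never merges two monomials.
\<close>

lemma lookup_dehom_homogeneous:
  assumes "homogeneous d p" "mdeg \<alpha> = d"
  shows "lookup (dehom p) (erase0 \<alpha>) = lookup p \<alpha>"
proof -
  have "\<beta> = \<alpha>" if "\<beta> \<in> keys p" "erase0 \<beta> = erase0 \<alpha>" for \<beta>
  proof -
    have "mdeg \<beta> = mdeg \<alpha>"
      using that assms by (simp add: homogeneous_def)
    then have "lookup \<beta> 0 = lookup \<alpha> 0"
      using that(2) mdeg_erase0[of \<alpha>] mdeg_erase0[of \<beta>] by simp
    moreover have "\<beta> = erase0 \<beta> + Poly_Mapping.single 0 (lookup \<beta> 0)"
      by (rule erase0_split)
    ultimately have "\<beta> = erase0 \<alpha> + Poly_Mapping.single 0 (lookup \<alpha> 0)"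
      using that(2) by simp
    then show ?thesis
      by (simp flip: erase0_split)
  qed
  then have "linear_form (\<lambda>\<beta>. if erase0 \<beta> = erase0 \<alpha> then 1 else 0) p
      = linear_form (\<lambda>\<beta>. if \<beta> = \<alpha> then 1 else 0) p"
    by (intro linear_form_cong) metis
  then show ?thesis
    by (simp add: lookup_eq_linear_form linear_form_dehom)
qed

text \<open>
  Meant for \<open>p\<close> of degree at most \<open>d\<close>; terms of larger degree are left as they are, since the
  subtraction is truncated.
\<close>

definition homogenize :: "nat \<Rightarrow> 'k::field mpoly \<Rightarrow> 'k mpoly"
  where "homogenize d p =
    (\<Sum>\<alpha>\<in>keys p. mmonom (\<alpha> + Poly_Mapping.single 0 (d - mdeg \<alpha>)) (lookup p \<alpha>))"

lemma linear_form_homogenize: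
  "linear_form h (homogenize d p)
     = linear_form (\<lambda>\<alpha>. h (\<alpha> + Poly_Mapping.single 0 (d - mdeg \<alpha>))) p"
  unfolding homogenize_def linear_form_sum linear_form_monomial by (simp add: linear_form_def)

lemma homogenize_sum: "homogenize d (\<Sum>i\<in>A. p i) = (\<Sum>i\<in>A. homogenize d (p i))"
  by (rule poly_eqI_linear_form) (simp add: linear_form_homogenize linear_form_sum)

lemma polys_in_homogenize:
  assumes "p \<in> polys_in {1..n}"
  shows "homogenize d p \<in> polys_in {0..n}"
  unfolding homogenize_def
proof (intro polys_in_sum polys_in_monomial)
  fix \<alpha> assume "\<alpha> \<in> keys p"
  then show "keys (\<alpha> + Poly_Mapping.single 0 (d - mdeg \<alpha>)) \<subseteq> {0..n}"
    using assms keys_add[of \<alpha> "Poly_Mapping.single 0 (d - mdeg \<alpha>)"]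
    by (fastforce simp: polys_in_def split: if_splits)
qed

lemma homogeneous_homogenize:
  assumes "\<And>\<alpha>. \<alpha> \<in> keys p \<Longrightarrow> mdeg \<alpha> \<le> d"
  shows "homogeneous d (homogenize d p)"
proof -
  have "hom_component d (homogenize d p) = homogenize d p"
    unfolding homogenize_def hom_component_sum
    by (intro sum.cong refl) (use assms in \<open>simp add: hom_component_monomial\<close>)
  then show ?thesis
    using homogeneous_hom_component by metis
qed

lemma dehom_homogenize:
  assumes "p \<in> polys_in {1..n}"
  shows "dehom (homogenize d p) = p"
proof (rule poly_eqI_linear_form)
  fix h :: "expo \<Rightarrow> 'a"
  show "linear_form h (dehom (homogenize d p)) = linear_form h p"
    unfolding linear_form_dehom linear_form_homogenize
    by (rule linear_form_cong) (use assms in \<open>force simp: polys_in_def erase0_id\<close>)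
qed

lemma homogenize_dehom:
  assumes "homogeneous d p"
  shows "homogenize d (dehom p) = p"
proof (rule poly_eqI_linear_form)
  fix h :: "expo \<Rightarrow> 'a"
  have "erase0 \<alpha> + Poly_Mapping.single 0 (d - mdeg (erase0 \<alpha>)) = \<alpha>" if "\<alpha> \<in> keys p" for \<alpha>
  proof -
    have "d - mdeg (erase0 \<alpha>) = lookup \<alpha> 0"
      using that assms mdeg_erase0[of \<alpha>] by (simp add: homogeneous_def)
    then show ?thesis
      by (simp flip: erase0_split)
  qed
  then show "linear_form h (homogenize d (dehom p)) = linear_form h p"
    unfolding linear_form_dehom linear_form_homogenize by (intro linear_form_cong) simp
qed

lemma homogenize_shift:
  assumes "\<And>\<alpha>. \<alpha> \<in> keys p \<Longrightarrow> mdeg \<alpha> \<le> d" "d \<le> e"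
  shows "homogenize e p = Y 0 ^ (e - d) * homogenize d p"
proof (rule poly_eqI_linear_form)
  fix h :: "expo \<Rightarrow> 'a"
  have "\<alpha> + Poly_Mapping.single 0 (e - mdeg \<alpha>)
      = Poly_Mapping.single 0 (e - d) + (\<alpha> + Poly_Mapping.single 0 (d - mdeg \<alpha>))"
    if "\<alpha> \<in> keys p" for \<alpha>
  proof -
    have "e - mdeg \<alpha> = (e - d) + (d - mdeg \<alpha>)"
      using assms(1)[OF that] assms(2) by simp
    then show ?thesis
      by (simp add: single_add add_ac)
  qed
  then show "linear_form h (homogenize e p) = linear_form h (Y 0 ^ (e - d) * homogenize d p)"
    unfolding Y_power linear_form_monomial_mult linear_form_homogenize
    by (simp cong: linear_form_cong)
qed

section \<open>Dimensions of quotient rings\<close>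

text \<open>
  Rank and nullity: the kernel contains \<open>a\<close>, so its dimension is positive.
\<close>

lemma (in ring_hom_ring) dim_image_less:
  assumes K: "subfield K R" and one_zero: "\<one>\<^bsub>S\<^esub> \<noteq> \<zero>\<^bsub>S\<^esub>" and surj: "h ` carrier R = carrier S"
    and fin: "R.finite_dimension K (carrier R)"
    and a: "a \<in> carrier R" "a \<noteq> \<zero>" "h a = \<zero>\<^bsub>S\<^esub>"
  shows "dim (h ` K) (carrier S) < R.dim K (carrier R)"
proof -
  obtain n where n: "R.dimension n K (carrier R)"
    using fin unfolding R.finite_dimension_def by blast
  have "subalgebra K (a_kernel R S h) R"
    by (rule R.ideal_is_subalgebra[OF _ kernel_is_ideal]) (rule subfieldE(3)[OF K])
  moreover have "a_kernel R S h \<subseteq> carrier R"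
    by (rule additive_subgroup.a_subset[OF ideal.axioms(1)[OF kernel_is_ideal]])
  ultimately obtain m where m: "R.dimension m K (a_kernel R S h)"
    using R.subalbegra_incl_imp_finite_dimension[OF K fin] unfolding R.finite_dimension_def by blast
  have "a \<in> a_kernel R S h"
    unfolding a_kernel_def' using a by blast
  then have "m \<noteq> 0" "n \<noteq> 0"
    using R.dimension_zero[OF K, of "a_kernel R S h"] R.dimension_zero[OF K, of "carrier R"] m n a(1,2)
    by (metis singletonD)+
  moreover have "dimension (n - m) (h ` K) (carrier S)"
    using rank_nullity_theorem[OF K one_zero n, of m] m unfolding surj by simp
  ultimately show ?thesis
    using R.dimI[OF K n] dimI[OF img_is_subfield(2)[OF K one_zero]] by (simp add: over_def)
qed

context ring
begin

text \<open>
  For \<open>I \<subseteq> J\<close> the projection \<open>R/I \<rightarrow> R/J\<close> can be written without choosing representatives as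
  \<open>X \<mapsto> J + X\<close>.
\<close>

lemma set_add_ideal_coset:
  assumes "ideal I R" "ideal J R" "I \<subseteq> J" "a \<in> carrier R"
  shows "J <+>\<^bsub>R\<^esub> (I +> a) = J +> a"
proof -
  interpret I: ideal I R by fact
  interpret J: ideal J R by fact
  show ?thesis
  proof
    show "J <+>\<^bsub>R\<^esub> (I +> a) \<subseteq> J +> a"
    proof
      fix x assume "x \<in> J <+>\<^bsub>R\<^esub> (I +> a)"
      then obtain j i where ji: "j \<in> J" "i \<in> I" "x = j \<oplus> (i \<oplus> a)"
        by (auto simp: set_add_def' a_r_coset_def')
      then have "x = (j \<oplus> i) \<oplus> a" "j \<oplus> i \<in> J"
        using assms(3,4) by (auto simp: a_assoc I.Icarr J.Icarr)
      then show "x \<in> J +> a"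
        by (auto simp: a_r_coset_def')
    qed
    show "J +> a \<subseteq> J <+>\<^bsub>R\<^esub> (I +> a)"
    proof
      fix x assume "x \<in> J +> a"
      then obtain j where j: "j \<in> J" "x = j \<oplus> a"
        by (auto simp: a_r_coset_def')
      moreover have "a \<in> I +> a"
        by (rule I.a_rcos_self) (rule assms(4))
      ultimately show "x \<in> J <+>\<^bsub>R\<^esub> (I +> a)"
        by (auto simp: set_add_def')
    qed
  qed
qed

lemma carrier_quotient: "carrier (R Quot I) = (+>) I ` carrier R"
  by (auto simp: FactRing_def A_RCOSETS_def')

lemma quotient_map_hom:
  assumes "ideal I R" "ideal J R" "I \<subseteq> J"
  shows "ring_hom_ring (R Quot I) (R Quot J) (\<lambda>X. J <+>\<^bsub>R\<^esub> X)"
proof -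
  interpret I: ideal I R by fact
  interpret J: ideal J R by fact
  interpret pI: ring_hom_ring R "R Quot I" "(+>) I" by (rule I.rcos_ring_hom_ring)
  interpret pJ: ring_hom_ring R "R Quot J" "(+>) J" by (rule J.rcos_ring_hom_ring)
  have rep: "\<exists>a\<in>carrier R. X = I +> a" if "X \<in> carrier (R Quot I)" for X
    using that unfolding carrier_quotient by blast
  note proj = set_add_ideal_coset[OF assms]
  have "(\<lambda>X. J <+>\<^bsub>R\<^esub> X) \<in> ring_hom (R Quot I) (R Quot J)"
  proof (rule ring_hom_memI)
    fix X assume "X \<in> carrier (R Quot I)"
    then obtain a where "a \<in> carrier R" "X = I +> a"
      using rep by blast
    then show "J <+>\<^bsub>R\<^esub> X \<in> carrier (R Quot J)"
      using proj carrier_quotient by blast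
  next
    fix X Y assume "X \<in> carrier (R Quot I)" "Y \<in> carrier (R Quot I)"
    then obtain a b where a: "a \<in> carrier R" "X = I +> a" and b: "b \<in> carrier R" "Y = I +> b"
      using rep by blast
    have "J <+>\<^bsub>R\<^esub> (X \<otimes>\<^bsub>R Quot I\<^esub> Y) = J <+>\<^bsub>R\<^esub> (I +> (a \<otimes> b))"
      unfolding a(2) b(2) pI.hom_mult[OF a(1) b(1)] ..
    also have "\<dots> = J +> (a \<otimes> b)"
      by (rule proj) (rule m_closed[OF a(1) b(1)])
    also have "\<dots> = (J +> a) \<otimes>\<^bsub>R Quot J\<^esub> (J +> b)"
      by (rule pJ.hom_mult[OF a(1) b(1)])
    finally show "J <+>\<^bsub>R\<^esub> (X \<otimes>\<^bsub>R Quot I\<^esub> Y) = (J <+>\<^bsub>R\<^esub> X) \<otimes>\<^bsub>R Quot J\<^esub> (J <+>\<^bsub>R\<^esub> Y)"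
      unfolding a(2) b(2) proj[OF a(1)] proj[OF b(1)] .
    have "J <+>\<^bsub>R\<^esub> (X \<oplus>\<^bsub>R Quot I\<^esub> Y) = J <+>\<^bsub>R\<^esub> (I +> (a \<oplus> b))"
      unfolding a(2) b(2) pI.hom_add[OF a(1) b(1)] ..
    also have "\<dots> = J +> (a \<oplus> b)"
      by (rule proj) (rule a_closed[OF a(1) b(1)])
    also have "\<dots> = (J +> a) \<oplus>\<^bsub>R Quot J\<^esub> (J +> b)"
      by (rule pJ.hom_add[OF a(1) b(1)])
    finally show "J <+>\<^bsub>R\<^esub> (X \<oplus>\<^bsub>R Quot I\<^esub> Y) = (J <+>\<^bsub>R\<^esub> X) \<oplus>\<^bsub>R Quot J\<^esub> (J <+>\<^bsub>R\<^esub> Y)"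
      unfolding a(2) b(2) proj[OF a(1)] proj[OF b(1)] .
  next
    have "J <+>\<^bsub>R\<^esub> (I +> \<one>) = J +> \<one>"
      by (rule proj) (rule one_closed)
    then show "J <+>\<^bsub>R\<^esub> \<one>\<^bsub>R Quot I\<^esub> = \<one>\<^bsub>R Quot J\<^esub>"
      unfolding pI.hom_one pJ.hom_one .
  qed
  then show ?thesis
    by (rule ring_hom_ringI2[OF pI.S.ring_axioms pJ.S.ring_axioms])
qed

lemma coset_eq_zero_iff:
  assumes "ideal I R" "a \<in> carrier R"
  shows "I +> a = \<zero>\<^bsub>R Quot I\<^esub> \<longleftrightarrow> a \<in> I"
proof -
  interpret I: ideal I R by fact
  show ?thesis
    using assms(2) I.a_rcos_self[of a] I.a_rcos_const[of a]
    by (auto simp: FactRing_def)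
qed

text \<open>
  The projection \<open>R/I \<rightarrow> R/J\<close> is surjective and kills the nonzero class of any element of \<open>J\<close>
  outside \<open>I\<close>.
\<close>

lemma dim_quotient_less:
  assumes I: "ideal I R" and J: "ideal J R" and "I \<subset> J" and "\<one> \<notin> J" and K: "subfield K R"
    and fin: "ring.finite_dimension (R Quot I) ((+>) I ` K) (carrier (R Quot I))"
  shows "ring.dim (R Quot J) ((+>) J ` K) (carrier (R Quot J))
       < ring.dim (R Quot I) ((+>) I ` K) (carrier (R Quot I))"
proof -
  interpret I: ideal I R by fact
  interpret J: ideal J R by fact
  interpret pI: ring_hom_ring R "R Quot I" "(+>) I" by (rule I.rcos_ring_hom_ring)
  interpret pJ: ring_hom_ring R "R Quot J" "(+>) J" by (rule J.rcos_ring_hom_ring)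
  interpret h: ring_hom_ring "R Quot I" "R Quot J" "\<lambda>X. J <+>\<^bsub>R\<^esub> X"
    by (rule quotient_map_hom) (use assms in auto)
  have proj: "J <+>\<^bsub>R\<^esub> (I +> a) = J +> a" if "a \<in> carrier R" for a
    using that assms by (intro set_add_ideal_coset) auto
  have one: "\<one>\<^bsub>R Quot I\<^esub> \<noteq> \<zero>\<^bsub>R Quot I\<^esub>" "\<one>\<^bsub>R Quot J\<^esub> \<noteq> \<zero>\<^bsub>R Quot J\<^esub>"
    using coset_eq_zero_iff[OF I one_closed] coset_eq_zero_iff[OF J one_closed] assms(3,4) by auto
  have KR: "K \<subseteq> carrier R"
    by (rule subfieldE(3)[OF K])
  have img: "(\<lambda>X. J <+>\<^bsub>R\<^esub> X) ` ((+>) I ` A) = (+>) J ` A" if "A \<subseteq> carrier R" for A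
    using that proj by (auto simp: image_image subset_iff intro!: image_cong)
  obtain a where a: "a \<in> J" "a \<notin> I"
    using assms(3) by blast
  have "pJ.S.dim ((\<lambda>X. J <+>\<^bsub>R\<^esub> X) ` ((+>) I ` K)) (carrier (R Quot J))
      < pI.S.dim ((+>) I ` K) (carrier (R Quot I))"
  proof (rule h.dim_image_less)
    show "subfield ((+>) I ` K) (R Quot I)"
      by (rule pI.img_is_subfield(2)[OF K one(1)])
    show "(\<lambda>X. J <+>\<^bsub>R\<^esub> X) ` carrier (R Quot I) = carrier (R Quot J)"
      unfolding carrier_quotient by (rule img) simp
    show "I +> a \<in> carrier (R Quot I)" "I +> a \<noteq> \<zero>\<^bsub>R Quot I\<^esub>" "J <+>\<^bsub>R\<^esub> (I +> a) = \<zero>\<^bsub>R Quot J\<^esub>"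
      using a coset_eq_zero_iff[OF I, of a] coset_eq_zero_iff[OF J, of a] by (auto simp: proj J.Icarr)
  qed (use one fin in auto)
  then show ?thesis
    by (simp only: img[OF KR])
qed

lemma finite_dimension_quotient:
  assumes I: "ideal I R" and "\<one> \<notin> I" and K: "subfield K R" and Us: "set Us \<subseteq> carrier R"
    and cover: "\<And>a. a \<in> carrier R \<Longrightarrow> \<exists>b\<in>Span K Us. I +> a = I +> b"
  shows "ring.finite_dimension (R Quot I) ((+>) I ` K) (carrier (R Quot I))"
proof -
  interpret I: ideal I R by fact
  interpret pI: ring_hom_ring R "R Quot I" "(+>) I" by (rule I.rcos_ring_hom_ring)
  have one: "\<one>\<^bsub>R Quot I\<^esub> \<noteq> \<zero>\<^bsub>R Quot I\<^esub>"
    using coset_eq_zero_iff[OF I one_closed] assms(2) by auto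
  have "carrier (R Quot I) = (+>) I ` Span K Us"
    unfolding carrier_quotient
  proof
    show "(+>) I ` carrier R \<subseteq> (+>) I ` Span K Us"
      using cover by blast
    show "(+>) I ` Span K Us \<subseteq> (+>) I ` carrier R"
      by (rule image_mono) (rule Span_subgroup_props(1)[OF K Us])
  qed
  also have "\<dots> = pI.S.Span ((+>) I ` K) (map ((+>) I) Us)"
    by (rule pI.Span_hom[symmetric, OF subfieldE(3)[OF K] Us])
  finally show ?thesis
    using pI.S.Span_finite_dimension[OF pI.img_is_subfield(2)[OF K one], of "map ((+>) I) Us"] Us
    by (metis carrier_quotient image_mono set_map)
qed

end

section \<open>Homogeneous primes and the support of a scheme\<close>

lemma hom_component_mult_homogeneous:
  assumes "homogeneous k q"
  shows "hom_component (k + e) (q * p) = q * hom_component e p"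
proof -
  have "hom_component (k + e) (q * p)
      = (\<Sum>i\<le>k + e. if i = k then q * hom_component (k + e - i) p else 0)"
    unfolding hom_component_mult
    by (intro sum.cong) (auto simp: hom_component_homogeneous[OF assms])
  then show ?thesis
    by simp
qed

lemma homogeneous_idealD:
  assumes "homogeneous_ideal n I"
  shows "ideal I (mpoly_ring {0..n})" "p \<in> I \<Longrightarrow> hom_component e p \<in> I"
  using assms by (auto simp: homogeneous_ideal_def)

text \<open>
  The \<open>e\<close>-th component of \<open>r a\<close> is again a multiple of \<open>a\<close> because \<open>a\<close> is homogeneous: only one
  component of \<open>r\<close> contributes.
\<close>

lemma homogeneous_ideal_add_principal:
  fixes a :: "'k::field mpoly"
  assumes M: "homogeneous_ideal n M" and a: "a \<in> polys_in {0..n}" "homogeneous d a"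
  shows "homogeneous_ideal n {m + r * a |m r. m \<in> M \<and> r \<in> polys_in {0..n}}"
    (is "homogeneous_ideal n ?N")
  unfolding homogeneous_ideal_def
proof (intro conjI ballI allI)
  note M' = homogeneous_idealD(1)[OF M]
  show "ideal ?N (mpoly_ring {0..n})"
  proof (rule idealI_mpoly)
    show "?N \<subseteq> polys_in {0..n}"
      using a(1) ideal_subset[OF M'] by (auto intro!: polys_in_add polys_in_mult)
    have "0 = 0 + 0 * a" by simp
    then show "0 \<in> ?N"
      using ideal_zero[OF M'] polys_in_simps(1) by blast
  next
    fix p q assume "p \<in> ?N" "q \<in> ?N"
    then obtain m r m' r' where *: "p = m + r * a" "m \<in> M" "r \<in> polys_in {0..n}"
      "q = m' + r' * a" "m' \<in> M" "r' \<in> polys_in {0..n}"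
      by blast
    then have "p + q = (m + m') + (r + r') * a"
      by (simp add: algebra_simps)
    then show "p + q \<in> ?N"
      using * ideal_add[OF M'] polys_in_add by blast
  next
    fix p q :: "'k mpoly" assume "p \<in> ?N" and q: "q \<in> polys_in {0..n}"
    then obtain m r where *: "p = m + r * a" "m \<in> M" "r \<in> polys_in {0..n}"
      by blast
    then have "q * p = q * m + (q * r) * a"
      by (simp add: algebra_simps)
    then show "q * p \<in> ?N"
      using * q ideal_mult[OF M'] polys_in_mult by blast
  qed
next
  fix p e assume "p \<in> ?N"
  then obtain m r where *: "p = m + r * a" "m \<in> M" "r \<in> polys_in {0..n}"
    by blast
  define s where "s = (\<Sum>i\<le>e. if e - i = d then hom_component i r else 0)"
  have "hom_component e (r * a) = s * a"
    unfolding hom_component_mult s_def sum_distrib_right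
    by (intro sum.cong) (auto simp: hom_component_homogeneous[OF a(2)])
  then have "hom_component e p = hom_component e m + s * a"
    by (simp add: * hom_component_add)
  moreover have "s \<in> polys_in {0..n}"
    unfolding s_def using *(3) by (intro polys_in_sum) (auto intro: polys_in_hom_component)
  ultimately show "hom_component e p \<in> ?N"
    using homogeneous_idealD(2)[OF M *(2)] by blast
qed

text \<open>
  Almost all components of \<open>a\<close> vanish, and not all of them lie in \<open>M\<close> since \<open>a\<close> is their sum.
\<close>

lemma highest_component_outside:
  fixes a :: "'k::field mpoly"
  assumes M: "ideal M (mpoly_ring V)" and "a \<notin> M"
  obtains e where "hom_component e a \<notin> M" "\<And>i. i > e \<Longrightarrow> hom_component i a \<in> M"
proof -
  obtain N where N: "\<And>\<alpha>. \<alpha> \<in> keys a \<Longrightarrow> mdeg \<alpha> \<le> N"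
    using degree_bound[of a] by blast
  let ?E = "{e. hom_component e a \<notin> M}"
  have "?E \<subseteq> {..N}"
  proof
    fix e assume e: "e \<in> ?E"
    then have "hom_component e a \<noteq> 0"
      using ideal_zero[OF M] by auto
    then have "keys (hom_component e a) \<noteq> {}"
      by simp
    then show "e \<in> {..N}"
      using N by (auto simp: keys_hom_component)
  qed
  then have "finite ?E"
    by (rule finite_subset) simp
  moreover have "?E \<noteq> {}"
    using assms(2) ideal_sum[OF M, of "{..N}" "\<lambda>e. hom_component e a"] sum_hom_components[of a N] N
    by auto
  ultimately have "Max ?E \<in> ?E" and "\<And>i. i \<in> ?E \<Longrightarrow> i \<le> Max ?E"
    by (rule Max_in, intro Max_ge)
  then have "hom_component (Max ?E) a \<notin> M" "\<And>i. i > Max ?E \<Longrightarrow> hom_component i a \<in> M"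
    by (blast, metis leD mem_Collect_eq)
  then show ?thesis
    by (rule that)
qed

text \<open>
  The graded form of the fact that an element of every prime over \<open>I\<close> has a power in \<open>I\<close>.
  Take \<open>M\<close> maximal among the homogeneous ideals over \<open>I\<close> that contain no power of \<open>q\<close>.
  Adjoining a homogeneous element to \<open>M\<close> gives a homogeneous ideal again, whereas an arbitrary
  element need not, so primality is reduced to homogeneous elements: if \<open>a b \<in> M\<close> and \<open>e\<close>, \<open>f\<close> are the
  highest degrees in which \<open>a\<close>, \<open>b\<close> have a component outside \<open>M\<close>, then the component of \<open>a b\<close>
  of degree \<open>e + f\<close> is congruent modulo \<open>M\<close> to the product of these two components.
\<close>

lemma homogeneous_prime_avoiding_powers:
  fixes q :: "'k::field mpoly"
  assumes I: "homogeneous_ideal n I" and avoid: "\<And>k. q ^ k \<notin> I"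
  obtains M where "homogeneous_ideal n M" "primeideal M (mpoly_ring {0..n})" "I \<subseteq> M" "q \<notin> M"
proof -
  let ?R = "polys_in {0..n} :: 'k mpoly set"
  define A where "A = {M. homogeneous_ideal n M \<and> I \<subseteq> M \<and> (\<forall>k. q ^ k \<notin> M)}"
  have "\<exists>M\<in>A. \<forall>X\<in>A. M \<subseteq> X \<longrightarrow> X = M"
  proof (rule subset_Zorn_nonempty)
    show "A \<noteq> {}"
      using I avoid by (auto simp: A_def)
  next
    fix C assume C: "C \<noteq> {}" "subset.chain A C"
    then have CA: "M \<in> A" "ideal M (mpoly_ring {0..n})" if "M \<in> C" for M
      using that by (auto simp: subset.chain_def A_def homogeneous_ideal_def)
    have "ideal (\<Union>C) (mpoly_ring {0..n})"
    proof (rule idealI_mpoly)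
      show "\<Union>C \<subseteq> ?R" "0 \<in> \<Union>C"
        using C(1) CA(2) ideal_subset ideal_zero by blast+
    next
      fix p q assume "p \<in> \<Union>C" "q \<in> \<Union>C"
      then obtain X Y where XY: "X \<in> C" "p \<in> X" "Y \<in> C" "q \<in> Y"
        by blast
      moreover have "X \<subseteq> Y \<or> Y \<subseteq> X"
        using C(2) XY by (auto simp: subset.chain_def)
      ultimately show "p + q \<in> \<Union>C"
        using ideal_add[OF CA(2)[OF XY(1)]] ideal_add[OF CA(2)[OF XY(3)]] by blast
    next
      fix p q :: "'k mpoly" assume "p \<in> \<Union>C" "q \<in> ?R"
      then obtain X where X: "X \<in> C" "p \<in> X"
        by blast
      then show "q * p \<in> \<Union>C"
        using ideal_mult[OF CA(2)[OF X(1)] X(2) \<open>q \<in> ?R\<close>] by blast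
    qed
    moreover have "hom_component e p \<in> \<Union>C" if "p \<in> \<Union>C" for p e
      using that CA(1) unfolding A_def homogeneous_ideal_def by blast
    moreover have "I \<subseteq> \<Union>C" "q ^ k \<notin> \<Union>C" for k
      using C(1) CA(1) unfolding A_def by blast+
    ultimately show "\<Union>C \<in> A"
      unfolding A_def homogeneous_ideal_def by blast
  qed
  then obtain M where M: "M \<in> A" and max: "\<And>X. X \<in> A \<Longrightarrow> M \<subseteq> X \<Longrightarrow> X = M"
    by blast
  then have hM: "homogeneous_ideal n M" and IM: "I \<subseteq> M" and qM: "\<And>k. q ^ k \<notin> M"
    by (auto simp: A_def)
  note M' = homogeneous_idealD(1)[OF hM]
  \<comment> \<open>The ideal \<open>M + (a)\<close> is homogeneous and larger than \<open>M\<close>, so it contains a power of \<open>q\<close>.\<close>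
  have power_mem: "\<exists>k. \<exists>m\<in>M. \<exists>r\<in>?R. q ^ k = m + r * a"
    if a: "a \<in> ?R" "homogeneous d a" "a \<notin> M" for a d
  proof (rule ccontr)
    assume neg: "\<not> ?thesis"
    let ?N = "{m + r * a |m r. m \<in> M \<and> r \<in> ?R}"
    have "m \<in> ?N" if "m \<in> M" for m
      using that polys_in_simps(1)[of "{0..n}"] by force
    then have "M \<subseteq> ?N"
      by blast
    moreover from this have "?N \<in> A"
      using homogeneous_ideal_add_principal[OF hM a(1,2)] IM neg unfolding A_def by blast
    moreover have "a \<in> ?N"
      using ideal_zero[OF M'] polys_in_simps(2)[of "{0..n}"] by force
    ultimately show False
      using max a(3) by blast
  qed
  have "primeideal M (mpoly_ring {0..n})"
  proof (rule primeidealI[OF M' cring_mpoly_ring])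
    show "carrier (mpoly_ring {0..n}) \<noteq> M"
      using qM[of 0] polys_in_simps(2)[of "{0..n}"] by auto
  next
    fix a b :: "'k mpoly"
    assume ab: "a \<in> carrier (mpoly_ring {0..n})" "b \<in> carrier (mpoly_ring {0..n})"
      "a \<otimes>\<^bsub>mpoly_ring {0..n}\<^esub> b \<in> M"
    show "a \<in> M \<or> b \<in> M"
    proof (rule ccontr)
      assume neg: "\<not> (a \<in> M \<or> b \<in> M)"
      obtain e where e: "hom_component e a \<notin> M" "\<And>i. i > e \<Longrightarrow> hom_component i a \<in> M"
        using highest_component_outside[OF M'] neg by blast
      obtain f where f: "hom_component f b \<notin> M" "\<And>i. i > f \<Longrightarrow> hom_component i b \<in> M"
        using highest_component_outside[OF M'] neg by blast
      define t where "t i = hom_component i a * hom_component (e + f - i) b" for i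
      have R: "hom_component i a \<in> ?R" "hom_component i b \<in> ?R" for i
        using ab by (auto intro: polys_in_hom_component)
      have "t i \<in> M" if "i \<noteq> e" for i
      proof (cases "i > e")
        case True
        then show ?thesis
          unfolding t_def using ideal_mult[OF M' e(2) R(2)] by (simp add: mult.commute)
      next
        case False
        then show ?thesis
          unfolding t_def using that by (intro ideal_mult[OF M' f(2) R(1)]) simp
      qed
      then have "(\<Sum>i\<in>{..e + f} - {e}. t i) \<in> M"
        by (intro ideal_sum[OF M']) auto
      moreover have "hom_component (e + f) (a * b) = t e + (\<Sum>i\<in>{..e + f} - {e}. t i)"
        unfolding hom_component_mult t_def by (rule sum.remove) auto
      moreover have "hom_component (e + f) (a * b) \<in> M"
        using ab(3) homogeneous_idealD(2)[OF hM] by simp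
      ultimately have te: "t e \<in> M"
        using ideal_diff[OF M'] by fastforce
      obtain k m r where k: "m \<in> M" "r \<in> ?R" "q ^ k = m + r * hom_component e a"
        using power_mem[OF R(1) homogeneous_hom_component e(1)] by blast
      obtain l m' r' where l: "m' \<in> M" "r' \<in> ?R" "q ^ l = m' + r' * hom_component f b"
        using power_mem[OF R(2) homogeneous_hom_component f(1)] by blast
      have "q ^ (k + l) = (m' + r' * hom_component f b) * m + (r * hom_component e a) * m' + (r * r') * t e"
        unfolding power_add k l t_def by (simp add: algebra_simps)
      also have "\<dots> \<in> M"
        using k l te R by (intro ideal_add[OF M'] ideal_mult[OF M'])
          (auto intro!: polys_in_add polys_in_mult intro: ideal_subset[OF M'])
      finally show False
        using qM by blast
    qed
  qed
  then show ?thesis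
    using that[of M] hM IM qM[of 1] by simp
qed

lemma primeideal_power_mem:
  fixes q :: "'k::field mpoly"
  assumes P: "primeideal P (mpoly_ring V)" and q: "q \<in> polys_in V" and "q ^ k \<in> P"
  shows "q \<in> P"
  using assms(3)
proof (induction k)
  case 0
  have "p \<in> P" if "p \<in> polys_in V" for p
    using ideal_mult[OF primeideal.axioms(1)[OF P], of 1 p] 0 that by simp
  then show ?case
    using q by blast
next
  case (Suc k)
  have "q ^ k \<in> polys_in V"
    by (induction k) (auto intro: polys_in_mult q)
  then show ?case
    using Suc primeideal.I_prime[OF P, of q "q ^ k"] q by auto
qed

lemma all_variables_in:
  assumes "Y 0 \<in> Q" "\<And>i. i \<in> {1..n} \<Longrightarrow> Y i \<in> Q"
  shows "Y ` {0..n} \<subseteq> Q"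
proof (rule image_subsetI)
  fix i assume "i \<in> {0..n}"
  then have "i = 0 \<or> i \<in> {1..n}"
    by auto
  then show "Y i \<in> Q"
    using assms by blast
qed

lemma Y_image_carrier:
  "A \<subseteq> V \<Longrightarrow> Y ` A \<subseteq> carrier (mpoly_ring V :: 'k::field mpoly ring)"
  by (auto simp: polys_in_monomial)

lemma Y_in_point_x0:
  assumes "i \<in> {1..n}"
  shows "(Y i :: 'k::field mpoly) \<in> point_x0 n"
proof -
  interpret cring "mpoly_ring {0..n} :: 'k mpoly ring"
    by (rule cring_mpoly_ring)
  have "Y ` {1..n} \<subseteq> carrier (mpoly_ring {0..n} :: 'k mpoly ring)"
    by (rule Y_image_carrier) simp
  then show ?thesis
    using assms genideal_self unfolding point_x0_def by blast
qed

lemma ideal_point_x0: "ideal (point_x0 n :: 'k::field mpoly set) (mpoly_ring {0..n})"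
proof -
  interpret cring "mpoly_ring {0..n} :: 'k mpoly ring"
    by (rule cring_mpoly_ring)
  show ?thesis
    unfolding point_x0_def by (rule genideal_ideal, rule Y_image_carrier) simp
qed

lemma point_x0_minimal:
  fixes Q :: "'k::field mpoly set"
  assumes "ideal Q (mpoly_ring {0..n})" "\<And>i. i \<in> {1..n} \<Longrightarrow> Y i \<in> Q"
  shows "point_x0 n \<subseteq> Q"
proof -
  interpret cring "mpoly_ring {0..n} :: 'k mpoly ring"
    by (rule cring_mpoly_ring)
  show ?thesis
    unfolding point_x0_def by (rule genideal_minimal) (use assms in auto)
qed

text \<open>
  A monomial that is not a power of \<open>y\<^sub>0\<close> is divisible by some \<open>y\<^sub>i\<close> with \<open>i \<ge> 1\<close>.
\<close>

lemma in_point_x0I: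
  fixes p :: "'k::field mpoly"
  assumes p: "p \<in> polys_in {0..n}" and "\<And>\<alpha>. \<alpha> \<in> keys p \<Longrightarrow> \<not> keys \<alpha> \<subseteq> {0}"
  shows "p \<in> point_x0 n"
proof -
  have "mmonom \<alpha> (lookup p \<alpha>) \<in> point_x0 n" if \<alpha>: "\<alpha> \<in> keys p" for \<alpha>
  proof -
    obtain i where i: "i \<in> keys \<alpha>" "i \<noteq> 0"
      using assms(2)[OF \<alpha>] by auto
    have k\<alpha>: "keys \<alpha> \<subseteq> {0..n}"
      using p \<alpha> by (auto simp: polys_in_def)
    define \<beta> where "\<beta> = \<alpha> - Poly_Mapping.single i 1"
    have \<alpha>_eq: "\<alpha> = \<beta> + Poly_Mapping.single i 1"
      unfolding \<beta>_def using i(1)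
      by (intro poly_mapping_eqI) (auto simp: lookup_add lookup_minus lookup_single when_def in_keys_iff)
    have "keys \<beta> \<subseteq> {0..n}"
      using k\<alpha> unfolding \<beta>_def by (auto simp: in_keys_iff lookup_minus)
    then have "mmonom \<beta> (lookup p \<alpha>) * Y i \<in> point_x0 n"
      using i k\<alpha> by (intro ideal_mult[OF ideal_point_x0] Y_in_point_x0 polys_in_monomial) auto
    moreover have "mmonom \<beta> (lookup p \<alpha>) * Y i = mmonom \<alpha> (lookup p \<alpha>)"
      unfolding mult_single \<alpha>_eq[symmetric] by simp
    ultimately show ?thesis
      by simp
  qed
  then have "(\<Sum>\<alpha>\<in>keys p. mmonom \<alpha> (lookup p \<alpha>)) \<in> point_x0 n"
    by (rule ideal_sum[OF ideal_point_x0])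
  then show ?thesis
    by (simp flip: sum_monomials)
qed

text \<open>
  If no power of \<open>y\<^sub>i\<close> were in \<open>Z\<close>, a homogeneous prime over \<open>Z\<close> would avoid \<open>y\<^sub>i\<close>.  It would be a
  point of the support, because it does not contain all variables, and it would differ from
  \<open>(y\<^sub>1,\<dots>,y\<^sub>n)\<close>.
\<close>

lemma nilpotent_of_support:
  fixes Z :: "'k::field mpoly set"
  assumes Z: "homogeneous_ideal n Z" and supp: "support n Z = {point_x0 n}"
  shows "\<exists>N. \<forall>i\<in>{1..n}. Y i ^ N \<in> Z"
proof -
  note Z' = homogeneous_idealD(1)[OF Z]
  have "\<exists>k. Y i ^ k \<in> Z" if i: "i \<in> {1..n}" for i
  proof (rule ccontr)
    assume "\<not> ?thesis"
    then obtain M :: "'k mpoly set"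
      where M: "homogeneous_ideal n M" "primeideal M (mpoly_ring {0..n})" "Z \<subseteq> M" "Y i \<notin> M"
      using homogeneous_prime_avoiding_powers[OF Z] by metis
    moreover have "i \<in> {0..n}"
      using i by simp
    ultimately have "M \<in> support n Z"
      unfolding support_def proj_points_def by blast
    then show False
      using supp M(4) Y_in_point_x0[OF i] by blast
  qed
  then obtain k where k: "\<And>i. i \<in> {1..n} \<Longrightarrow> (Y i :: 'k mpoly) ^ k i \<in> Z"
    by metis
  have "(Y i :: 'k mpoly) ^ (\<Sum>i\<in>{1..n}. k i) \<in> Z" if i: "i \<in> {1..n}" for i
  proof -
    have "k i \<le> (\<Sum>i\<in>{1..n}. k i)"
      using i by (intro member_le_sum) auto
    then have "(Y i :: 'k mpoly) ^ (\<Sum>i\<in>{1..n}. k i) = Y i ^ ((\<Sum>i\<in>{1..n}. k i) - k i) * Y i ^ k i"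
      by (simp only: power_add[symmetric] le_add_diff_inverse2)
    moreover have "Y i ^ ((\<Sum>i\<in>{1..n}. k i) - k i) * Y i ^ k i \<in> Z"
      by (intro ideal_mult[OF Z' k[OF i]] polys_in_Y_power) (use i in simp)
    ultimately show ?thesis
      by (simp only:)
  qed
  then show ?thesis
    by blast
qed

text \<open>
  Saturation asks that some power of each variable multiply \<open>p\<close> into \<open>Z\<close>; for the variables
  other than \<open>y\<^sub>0\<close> such powers already lie in \<open>Z\<close>.
\<close>

lemma saturated_cancel_Y0:
  fixes Z :: "'k::field mpoly set"
  assumes Z: "ideal Z (mpoly_ring {0..n})" and sat: "saturated n Z"
    and N: "\<And>i. i \<in> {1..n} \<Longrightarrow> Y i ^ N \<in> Z"
    and p: "p \<in> polys_in {0..n}" "Y 0 ^ k * p \<in> Z"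
  shows "p \<in> Z"
proof -
  have "\<exists>k. Y i ^ k * p \<in> Z" if "i \<le> n" for i
  proof (cases "i = 0")
    case True
    then show ?thesis
      using p(2) by blast
  next
    case False
    then have "i \<in> {1..n}"
      using that by simp
    then have "p * Y i ^ N \<in> Z"
      by (intro ideal_mult[OF Z N p(1)])
    then show ?thesis
      by (metis mult.commute)
  qed
  then show ?thesis
    using sat p(1) by (simp add: saturated_def)
qed

text \<open>
  A point \<open>Q\<close> of the support contains \<open>y\<^sub>1,\<dots>,y\<^sub>n\<close>.  If \<open>Q\<close> had a further element \<open>q\<close>, then \<open>q\<close>
  would have a term that is a power of \<open>y\<^sub>0\<close>.  Homogeneity isolates that term modulo
  \<open>(y\<^sub>1,\<dots>,y\<^sub>n)\<close>, so primality would put \<open>y\<^sub>0\<close> into \<open>Q\<close>, and \<open>Q\<close> would be irrelevant.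
\<close>

lemma support_eq_point:
  fixes Z :: "'k::field mpoly set"
  assumes sub: "Z \<subseteq> point_x0 n" and P: "point_x0 n \<in> (proj_points n :: 'k mpoly set set)"
    and nil: "\<And>i. i \<in> {1..n} \<Longrightarrow> \<exists>k. Y i ^ k \<in> Z"
  shows "support n Z = {point_x0 n}"
proof (intro equalityI subsetI; simp)
  fix Q assume "Q \<in> support n Z"
  then have ZQ: "Z \<subseteq> Q" and hQ: "homogeneous_ideal n Q" and primeQ: "primeideal Q (mpoly_ring {0..n})"
    and rel: "\<not> Y ` {0..n} \<subseteq> Q"
    by (auto simp: support_def proj_points_def)
  note Q' = homogeneous_idealD(1)[OF hQ]
  have Yi: "Y i \<in> Q" if "i \<in> {1..n}" for i
  proof -
    obtain k where "(Y i :: 'k mpoly) ^ k \<in> Q"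
      using nil[OF \<open>i \<in> {1..n}\<close>] ZQ by blast
    then show ?thesis
      using \<open>i \<in> {1..n}\<close> by (intro primeideal_power_mem[OF primeQ polys_in_Y]) auto
  qed
  then have PQ: "point_x0 n \<subseteq> Q"
    by (rule point_x0_minimal[OF Q'])
  have "q \<in> point_x0 n" if q: "q \<in> Q" for q
  proof (rule in_point_x0I, rule ideal_subset[OF Q' q], rule notI)
    fix \<alpha> assume \<alpha>: "\<alpha> \<in> keys q" "keys \<alpha> \<subseteq> {0}"
    define e where "e = mdeg \<alpha>"
    have pure: "\<beta> = Poly_Mapping.single 0 (mdeg \<beta>)" if "keys \<beta> \<subseteq> {0}" for \<beta> :: expo
      using that mdeg_superset[of "{0}" \<beta>]
      by (intro poly_mapping_eqI) (auto simp: lookup_single when_def in_keys_iff)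
    define c where "c = lookup q \<alpha>"
    \<comment> \<open>In degree \<open>e\<close> there is only one power of \<open>y\<^sub>0\<close>, so \<open>r\<close> has no such term left.\<close>
    define r where "r = hom_component e q - mmonom \<alpha> c"
    have kr: "\<beta> \<in> keys q \<and> mdeg \<beta> = e \<and> \<beta> \<noteq> \<alpha>" if "\<beta> \<in> keys r" for \<beta>
      using that by (auto simp: r_def c_def e_def in_keys_iff lookup_minus lookup_hom_component
          lookup_single when_def split: if_splits)
    have "r \<in> point_x0 n"
    proof (rule in_point_x0I)
      show "r \<in> polys_in {0..n}"
        using kr ideal_subset[OF Q' q] by (auto simp: polys_in_def)
    next
      fix \<beta> assume "\<beta> \<in> keys r"
      then show "\<not> keys \<beta> \<subseteq> {0}"
        using kr pure[of \<beta>] pure[OF \<alpha>(2)] by (auto simp: e_def)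
    qed
    then have "hom_component e q - r \<in> Q"
      using PQ homogeneous_idealD(2)[OF hQ q] by (intro ideal_diff[OF Q']) auto
    then have "mmonom \<alpha> c \<in> Q"
      by (simp add: r_def)
    then have "const (1 / c) * mmonom \<alpha> c \<in> Q"
      by (intro ideal_mult[OF Q']) auto
    moreover have "c \<noteq> 0"
      using \<alpha>(1) by (simp add: c_def in_keys_iff)
    ultimately have "mmonom \<alpha> 1 \<in> Q"
      by (simp add: mult_single)
    then have "Y 0 ^ e \<in> Q"
      unfolding Y_power using pure[OF \<alpha>(2)] by (simp add: e_def)
    then have "Y 0 \<in> Q"
      by (intro primeideal_power_mem[OF primeQ polys_in_Y]) auto
    then show False
      using rel all_variables_in[OF _ Yi] by blast
  qed
  then show "Q = point_x0 n"
    using PQ by blast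
next
  show "point_x0 n \<in> support n Z"
    using sub P by (simp add: support_def)
qed

lemma Y0_notin_point_x0:
  assumes "point_x0 n \<in> (proj_points n :: 'k::field mpoly set set)"
  shows "Y 0 \<notin> (point_x0 n :: 'k mpoly set)"
proof
  assume "Y 0 \<in> (point_x0 n :: 'k mpoly set)"
  then have "Y ` {0..n} \<subseteq> (point_x0 n :: 'k mpoly set)"
    by (rule all_variables_in) (rule Y_in_point_x0)
  then show False
    using assms by (simp add: proj_points_def)
qed

section \<open>Projective closure of an affine scheme\<close>

text \<open>
  The saturated homogeneous ideal of the closure in \<open>\<P>\<^sup>n\<close> of the affine scheme defined by \<open>J\<close>.
  It is generated by the homogeneous polynomials that lie in \<open>J\<close> after setting \<open>y\<^sub>0 = 1\<close>; asking
  this of every component describes the whole ideal without mentioning generators.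
\<close>

definition projective_closure :: "nat \<Rightarrow> 'k::field mpoly set \<Rightarrow> 'k mpoly set"
  where "projective_closure n J = {p \<in> polys_in {0..n}. \<forall>e. dehom (hom_component e p) \<in> J}"

lemma ideal_chart_ideal:
  fixes Z :: "'k::field mpoly set"
  assumes Z: "ideal Z (mpoly_ring {0..n})"
  shows "ideal (chart_ideal Z) (mpoly_ring {1..n})"
proof (rule idealI_mpoly)
  show "chart_ideal Z \<subseteq> polys_in {1..n}"
    using ideal_subset[OF Z] dehom_in by (auto simp: chart_ideal_def)
  show "0 \<in> chart_ideal Z"
    using ideal_zero[OF Z] by (force simp: chart_ideal_def)
next
  fix p q assume "p \<in> chart_ideal Z" "q \<in> chart_ideal Z"
  then obtain p' q' where "p' \<in> Z" "q' \<in> Z" "p = dehom p'" "q = dehom q'"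
    by (auto simp: chart_ideal_def)
  then show "p + q \<in> chart_ideal Z"
    using ideal_add[OF Z] by (auto simp: chart_ideal_def dehom_add[symmetric])
next
  fix p q :: "'k mpoly" assume "p \<in> chart_ideal Z" and q: "q \<in> polys_in {1..n}"
  then obtain p' where p': "p' \<in> Z" "p = dehom p'"
    by (auto simp: chart_ideal_def)
  have "q \<in> polys_in {0..n}"
    using q by (force simp: polys_in_def)
  then have "q * p' \<in> Z"
    using p' by (intro ideal_mult[OF Z])
  moreover have "q * p = dehom (q * p')"
    using q p' by (simp add: dehom_mult dehom_id)
  ultimately show "q * p \<in> chart_ideal Z"
    by (auto simp: chart_ideal_def)
qed

text \<open>
  Let \<open>\<psi>\<close> come from \<open>p \<in> Z\<close>.  Homogenising \<open>\<psi>\<close> in a large degree \<open>M\<close> multiplies the components of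
  \<open>p\<close> by powers of \<open>y\<^sub>0\<close> and adds them up, which stays in \<open>Z\<close>.  The result is the
  homogenisation in degree \<open>d\<close> times \<open>y\<^sub>0 ^ (M - d)\<close>, and this factor can be cancelled.
\<close>

lemma homogenize_mem:
  fixes Z :: "'k::field mpoly set"
  assumes Z: "homogeneous_ideal n Z"
    and sat: "\<And>k p. p \<in> polys_in {0..n} \<Longrightarrow> Y 0 ^ k * p \<in> Z \<Longrightarrow> p \<in> Z"
    and \<psi>: "\<psi> \<in> chart_ideal Z" "\<And>\<alpha>. \<alpha> \<in> keys \<psi> \<Longrightarrow> mdeg \<alpha> \<le> d"
  shows "homogenize d \<psi> \<in> Z"
proof -
  note Z' = homogeneous_idealD(1)[OF Z]
  obtain p where p: "p \<in> Z" "\<psi> = dehom p"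
    using \<psi>(1) by (auto simp: chart_ideal_def)
  obtain N where N: "\<And>\<alpha>. \<alpha> \<in> keys p \<Longrightarrow> mdeg \<alpha> \<le> N"
    using degree_bound[of p] by blast
  define M where "M = N + d"
  have psum: "p = (\<Sum>e\<le>M. hom_component e p)"
    by (rule sum_hom_components[symmetric]) (use N in \<open>force simp: M_def\<close>)
  have "homogenize M (dehom (hom_component e p)) \<in> Z" if "e \<le> M" for e
  proof -
    have "homogenize M (dehom (hom_component e p)) = Y 0 ^ (M - e) * homogenize e (dehom (hom_component e p))"
      by (rule homogenize_shift[OF mdeg_dehom_le that]) (rule homogeneous_hom_component)
    also have "\<dots> = Y 0 ^ (M - e) * hom_component e p"
      by (simp only: homogenize_dehom[OF homogeneous_hom_component])
    also have "\<dots> \<in> Z"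
      by (intro ideal_mult[OF Z'] homogeneous_idealD(2)[OF Z p(1)] polys_in_Y_power) simp
    finally show ?thesis .
  qed
  then have "(\<Sum>e\<le>M. homogenize M (dehom (hom_component e p))) \<in> Z"
    by (intro ideal_sum[OF Z']) simp
  also have "(\<Sum>e\<le>M. homogenize M (dehom (hom_component e p))) = homogenize M \<psi>"
  proof -
    have "homogenize M (dehom (\<Sum>e\<le>M. hom_component e p))
        = (\<Sum>e\<le>M. homogenize M (dehom (hom_component e p)))"
      by (simp only: dehom_sum homogenize_sum)
    then show ?thesis
      unfolding p(2) psum[symmetric] by (rule sym)
  qed
  also have "\<dots> = Y 0 ^ (M - d) * homogenize d \<psi>"
    using \<psi>(2) by (intro homogenize_shift) (auto simp: M_def)
  finally have "Y 0 ^ (M - d) * homogenize d \<psi> \<in> Z" .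
  moreover have "homogenize d \<psi> \<in> polys_in {0..n}"
    by (rule polys_in_homogenize[OF ideal_subset[OF ideal_chart_ideal[OF Z'] \<psi>(1)]])
  ultimately show ?thesis
    by (rule sat[rotated])
qed

lemma homogeneous_in_projective_closure:
  assumes "ideal J (mpoly_ring {1..n})" "homogeneous d p" "p \<in> polys_in {0..n}" "dehom p \<in> J"
  shows "p \<in> projective_closure n J"
  using assms ideal_zero[OF assms(1)]
  by (simp add: projective_closure_def hom_component_homogeneous)

lemma homogeneous_ideal_projective_closure:
  fixes J :: "'k::field mpoly set"
  assumes J: "ideal J (mpoly_ring {1..n})"
  shows "homogeneous_ideal n (projective_closure n J)"
  unfolding homogeneous_ideal_def
proof (intro conjI ballI allI)
  show "ideal (projective_closure n J) (mpoly_ring {0..n})"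
  proof (rule idealI_mpoly)
    fix p q :: "'k mpoly" assume p: "p \<in> projective_closure n J" and q: "q \<in> polys_in {0..n}"
    have "dehom (hom_component e (q * p)) \<in> J" for e
      unfolding hom_component_mult dehom_sum dehom_mult
      using p q by (intro ideal_sum[OF J] ideal_mult[OF J] dehom_in polys_in_hom_component)
        (auto simp: projective_closure_def)
    then show "q * p \<in> projective_closure n J"
      using p q by (simp add: projective_closure_def polys_in_mult)
  qed (auto simp: projective_closure_def hom_component_add dehom_add
      intro: polys_in_add ideal_zero[OF J] ideal_add[OF J])
next
  fix p e assume p: "p \<in> projective_closure n J"
  then show "hom_component e p \<in> projective_closure n J"
    by (intro homogeneous_in_projective_closure[OF J homogeneous_hom_component])
      (auto simp: projective_closure_def polys_in_hom_component)
qed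

text \<open>
  Cancelling a power of \<open>y\<^sub>0\<close>: it is homogeneous, so multiplying by it only shifts the components,
  and it becomes 1 in the chart.
\<close>

lemma saturated_projective_closure:
  fixes J :: "'k::field mpoly set"
  shows "saturated n (projective_closure n J)"
  unfolding saturated_def
proof (intro ballI impI)
  fix p :: "'k mpoly"
  assume p: "p \<in> carrier (mpoly_ring {0..n})" and "\<forall>i\<le>n. \<exists>k. Y i ^ k * p \<in> projective_closure n J"
  then obtain k where k: "Y 0 ^ k * p \<in> projective_closure n J"
    by blast
  have "homogeneous k ((Y 0 :: 'k mpoly) ^ k)"
    unfolding Y_power by (simp add: homogeneous_def)
  then have comp: "hom_component (k + e) (Y 0 ^ k * p) = Y 0 ^ k * hom_component e p" for e
    by (rule hom_component_mult_homogeneous)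
  have "dehom ((Y 0 :: 'k mpoly) ^ k) = 1"
    unfolding Y_power dehom_monomial by simp
  then have "dehom (hom_component e p) = dehom (hom_component (k + e) (Y 0 ^ k * p))" for e
    unfolding comp dehom_mult by (simp only: mult_1)
  moreover have "dehom (hom_component e (Y 0 ^ k * p)) \<in> J" for e
    using k unfolding projective_closure_def by blast
  ultimately have "dehom (hom_component e p) \<in> J" for e
    by (simp only:)
  then show "p \<in> projective_closure n J"
    using p by (simp add: projective_closure_def)
qed

lemma chart_ideal_projective_closure:
  fixes J :: "'k::field mpoly set"
  assumes J: "ideal J (mpoly_ring {1..n})"
  shows "chart_ideal (projective_closure n J) = J"
proof
  show "chart_ideal (projective_closure n J) \<subseteq> J"
  proof
    fix \<psi> assume "\<psi> \<in> chart_ideal (projective_closure n J)"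
    then obtain p where p: "p \<in> projective_closure n J" "\<psi> = dehom p"
      by (auto simp: chart_ideal_def)
    obtain N where N: "\<And>\<alpha>. \<alpha> \<in> keys p \<Longrightarrow> mdeg \<alpha> \<le> N"
      using degree_bound[of p] by blast
    have "dehom (\<Sum>e\<le>N. hom_component e p) \<in> J"
      unfolding dehom_sum using p(1) by (intro ideal_sum[OF J]) (simp add: projective_closure_def)
    moreover have "(\<Sum>e\<le>N. hom_component e p) = p"
      by (rule sum_hom_components) (rule N)
    ultimately show "\<psi> \<in> J"
      using p(2) by simp
  qed
next
  show "J \<subseteq> chart_ideal (projective_closure n J)"
  proof
    fix \<psi> assume \<psi>: "\<psi> \<in> J"
    note \<psi>' = ideal_subset[OF J \<psi>]
    obtain N where N: "\<And>\<alpha>. \<alpha> \<in> keys \<psi> \<Longrightarrow> mdeg \<alpha> \<le> N"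
      using degree_bound[of \<psi>] by blast
    have "homogeneous N (homogenize N \<psi>)"
      by (rule homogeneous_homogenize) (rule N)
    then have "homogenize N \<psi> \<in> projective_closure n J"
      using \<psi> dehom_homogenize[OF \<psi>', of N]
      by (intro homogeneous_in_projective_closure[OF J] polys_in_homogenize[OF \<psi>']) auto
    then show "\<psi> \<in> chart_ideal (projective_closure n J)"
      using dehom_homogenize[OF \<psi>', of N] unfolding chart_ideal_def by force
  qed
qed

lemma Y_power_in_projective_closure:
  fixes J :: "'k::field mpoly set"
  assumes J: "ideal J (mpoly_ring {1..n})" and "i \<in> {1..n}" "Y i ^ k \<in> J"
  shows "Y i ^ k \<in> projective_closure n J"
proof (rule homogeneous_in_projective_closure[OF J])
  show "homogeneous k ((Y i :: 'k mpoly) ^ k)"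
    unfolding Y_power by (simp add: homogeneous_def)
  show "Y i ^ k \<in> (polys_in {0..n} :: 'k mpoly set)"
    by (rule polys_in_Y_power) (use assms(2) in simp)
  show "dehom (Y i ^ k) \<in> J"
    using dehom_id[OF ideal_subset[OF J assms(3)]] assms(3) by (simp only:)
qed

lemma chart_power_mem:
  fixes Z :: "'k::field mpoly set"
  assumes "i \<in> {1..n}" "Y i ^ k \<in> Z"
  shows "Y i ^ k \<in> chart_ideal Z"
proof -
  have "dehom (Y i ^ k) = (Y i ^ k :: 'k mpoly)"
    by (rule dehom_id[OF polys_in_Y_power[OF assms(1)]])
  then show ?thesis
    using assms(2) unfolding chart_ideal_def by (metis imageI)
qed

section \<open>Apolarity in the chart\<close>

text \<open>
  The homogenisation of \<open>\<psi>\<close> has the same degree as \<open>F\<close>, so applying it to \<open>F\<close> gives a constant, the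
  sum of the products of corresponding coefficients.  The linear form below is this sum,
  computed in the chart.
\<close>

lemma apolar_chart_linear_form:
  fixes F :: "'k::field mpoly"
  assumes F: "homogeneous d F" and \<psi>: "\<psi> \<in> polys_in {1..n}" "\<And>\<alpha>. \<alpha> \<in> keys \<psi> \<Longrightarrow> mdeg \<alpha> \<le> d"
    and perp: "homogenize d \<psi> \<in> perp {0..n} F"
  shows "linear_form (lookup (dehom F)) \<psi> = 0"
proof -
  have "linear_form (\<lambda>\<alpha>. lookup F (\<alpha> + 0)) (homogenize d \<psi>) = 0"
    using perp unfolding perp_iff by blast
  moreover have "lookup F (\<alpha> + Poly_Mapping.single 0 (d - mdeg \<alpha>)) = lookup (dehom F) \<alpha>"
    if "\<alpha> \<in> keys \<psi>" for \<alpha>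
  proof -
    have "erase0 \<alpha> = \<alpha>"
      using \<psi>(1) that by (intro erase0_id) (force simp: polys_in_def)
    then show ?thesis
      using lookup_dehom_homogeneous[OF F, of "\<alpha> + Poly_Mapping.single 0 (d - mdeg \<alpha>)"] \<psi>(2)[OF that]
      by simp
  qed
  ultimately show ?thesis
    by (simp add: linear_form_homogenize cong: linear_form_cong)
qed

text \<open>
  Let \<open>p\<close> be homogeneous of degree \<open>e\<close>.  The coefficient of \<open>x\<^sup>\<gamma>\<close> in \<open>p(F)\<close> involves only coefficients of \<open>F\<close> at
  exponents of degree \<open>e + mdeg \<gamma>\<close>.  They are all zero unless this degree is \<open>d\<close>, and in that case
  they are coefficients of \<open>f\<close> in degree at most \<open>d\<close>, hence of \<open>g\<close>: the sum is a
  coefficient of \<open>\<psi>(g)\<close>, where \<open>\<psi>\<close> is \<open>p\<close> with \<open>y\<^sub>0 = 1\<close>.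
\<close>

lemma projective_closure_perp_apolar:
  fixes F g :: "'k::field mpoly"
  assumes F: "homogeneous d F"
    and g: "tail d g = dehom F"
  shows "projective_closure n (perp {1..n} g) \<subseteq> perp {0..n} F"
proof
  fix p assume p: "p \<in> projective_closure n (perp {1..n} g)"
  then have p_in: "p \<in> polys_in {0..n}"
    and comp: "dehom (hom_component e p) \<in> perp {1..n} g" for e
    by (auto simp: projective_closure_def)
  have "linear_form (\<lambda>\<alpha>. lookup F (\<alpha> + \<gamma>)) (hom_component e p) = 0" for e \<gamma>
  proof (cases "e + mdeg \<gamma> = d")
    case False
    have "lookup F (\<alpha> + \<gamma>) = 0" if "\<alpha> \<in> keys (hom_component e p)" for \<alpha>
    proof (rule ccontr)
      assume "lookup F (\<alpha> + \<gamma>) \<noteq> 0"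
      then have "mdeg (\<alpha> + \<gamma>) = d"
        using F by (simp add: homogeneous_def in_keys_iff del: mdeg_add)
      then show False
        using that False by (simp add: keys_hom_component)
    qed
    then show ?thesis
      by (rule linear_form_eq_0I)
  next
    case True
    have "lookup F (\<alpha> + \<gamma>) = lookup g (erase0 \<alpha> + erase0 \<gamma>)" if "\<alpha> \<in> keys (hom_component e p)" for \<alpha>
    proof -
      have deg: "mdeg (\<alpha> + \<gamma>) = d"
        using that True by (simp add: keys_hom_component)
      have "lookup F (\<alpha> + \<gamma>) = lookup (tail d g) (erase0 (\<alpha> + \<gamma>))"
        unfolding g by (rule lookup_dehom_homogeneous[OF F deg, symmetric])
      also have "\<dots> = lookup g (erase0 (\<alpha> + \<gamma>))"
        using deg mdeg_erase0[of "\<alpha> + \<gamma>"] by (simp add: lookup_tail)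
      finally show ?thesis
        by simp
    qed
    then have "linear_form (\<lambda>\<alpha>. lookup F (\<alpha> + \<gamma>)) (hom_component e p)
        = linear_form (\<lambda>\<alpha>. lookup g (\<alpha> + erase0 \<gamma>)) (dehom (hom_component e p))"
      unfolding linear_form_dehom by (rule linear_form_cong)
    then show ?thesis
      using comp[of e] by (simp add: perp_iff)
  qed
  moreover obtain N where "\<And>\<alpha>. \<alpha> \<in> keys p \<Longrightarrow> mdeg \<alpha> \<le> N"
    using degree_bound[of p] by blast
  then have "(\<Sum>e\<le>N. hom_component e p) = p"
    by (rule sum_hom_components)
  ultimately have "linear_form (\<lambda>\<alpha>. lookup F (\<alpha> + \<gamma>)) p = 0" for \<gamma>
    using linear_form_sum[of "\<lambda>\<alpha>. lookup F (\<alpha> + \<gamma>)" "\<lambda>e. hom_component e p" "{..N}"] by simp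
  then show "p \<in> perp {0..n} F"
    using p_in by (simp add: perp_iff)
qed

text \<open>
  If \<open>x\<^sup>\<gamma>\<close> is a monomial of \<open>g\<close> of top degree, its coefficient in \<open>\<psi>(g)\<close> receives a contribution from
  the constant term of \<open>\<psi>\<close> only, the other terms of \<open>\<psi>\<close> having lowered the degree.
\<close>

lemma perp_constant_term:
  fixes g :: "'k::field mpoly"
  assumes "g \<noteq> 0" "\<psi> \<in> perp V g"
  shows "lookup \<psi> 0 = 0"
proof -
  have "Max (mdeg ` keys g) \<in> mdeg ` keys g"
    using assms(1) by (intro Max_in) auto
  then obtain \<gamma> where \<gamma>: "\<gamma> \<in> keys g" "Max (mdeg ` keys g) = mdeg \<gamma>"
    by blast
  then have max: "mdeg \<beta> \<le> mdeg \<gamma>" if "\<beta> \<in> keys g" for \<beta>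
    using that by (metis Max_ge finite_imageI finite_keys imageI)
  have "lookup g (\<alpha> + \<gamma>) = 0" if "\<alpha> \<noteq> 0" for \<alpha>
  proof -
    have "\<alpha> = 0" if "mdeg \<alpha> = 0"
      by (rule poly_mapping_eqI) (use that in \<open>auto simp: mdeg_def in_keys_iff\<close>)
    with that have "mdeg \<alpha> \<noteq> 0"
      by blast
    then have "\<alpha> + \<gamma> \<notin> keys g"
      using max[of "\<alpha> + \<gamma>"] by auto
    then show ?thesis
      by (simp add: in_keys_iff)
  qed
  then have "linear_form (\<lambda>\<alpha>. lookup g (\<alpha> + \<gamma>)) \<psi>
      = linear_form (\<lambda>\<alpha>. lookup g \<gamma> * (if \<alpha> = 0 then 1 else 0)) \<psi>"
    by (intro linear_form_cong) auto
  also have "\<dots> = lookup g \<gamma> * lookup \<psi> 0"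
    by (simp only: linear_form_scale_left lookup_eq_linear_form[of \<psi>])
  finally show ?thesis
    using assms(2) \<gamma> by (simp add: perp_iff in_keys_iff)
qed

lemma projective_closure_perp_subset_point:
  fixes g :: "'k::field mpoly"
  assumes "g \<noteq> 0"
  shows "projective_closure n (perp {1..n} g) \<subseteq> point_x0 n"
proof
  fix p assume p: "p \<in> projective_closure n (perp {1..n} g)"
  show "p \<in> point_x0 n"
  proof (rule in_point_x0I)
    show "p \<in> polys_in {0..n}"
      using p by (simp add: projective_closure_def)
  next
    fix \<alpha> assume \<alpha>: "\<alpha> \<in> keys p"
    let ?q = "hom_component (mdeg \<alpha>) p"
    have "lookup (dehom ?q) 0 = 0"
      using p by (intro perp_constant_term[OF assms, of _ "{1..n}"]) (simp add: projective_closure_def)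
    moreover have "lookup (dehom ?q) (erase0 \<alpha>) = lookup p \<alpha>"
      using lookup_dehom_homogeneous[OF homogeneous_hom_component, of \<alpha> "mdeg \<alpha>" p]
      by (simp add: lookup_hom_component)
    ultimately have "erase0 \<alpha> \<noteq> 0"
      using \<alpha> by (auto simp: in_keys_iff)
    then show "\<not> keys \<alpha> \<subseteq> {0}"
      by (metis Diff_eq_empty_iff keys_eq_empty keys_erase0)
  qed
qed

section \<open>Polynomials modulo powers of the variables\<close>

definition low_exponents :: "nat \<Rightarrow> nat \<Rightarrow> expo set"
  where "low_exponents n N = {\<alpha>. keys \<alpha> \<subseteq> {1..n} \<and> (\<forall>i. lookup \<alpha> i \<le> N)}"

lemma finite_low_exponents: "finite (low_exponents n N)"
proof (rule finite_imageD)
  have "lookup ` low_exponents n N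
      \<subseteq> {f. \<forall>i. (i \<in> {1..n} \<longrightarrow> f i \<in> {..N}) \<and> (i \<notin> {1..n} \<longrightarrow> f i = 0)}"
    by (auto simp: low_exponents_def in_keys_iff subset_iff)
  then show "finite (lookup ` low_exponents n N)"
    by (rule finite_subset) (intro finite_set_of_finite_funs; simp)
  show "inj_on lookup (low_exponents n N)"
    by (metis inj_onI poly_mapping_eqI)
qed

lemma high_monomial_mem:
  fixes J :: "'k::field mpoly set"
  assumes J: "ideal J (mpoly_ring {1..n})" and pow: "\<And>i. i \<in> {1..n} \<Longrightarrow> Y i ^ N \<in> J"
    and \<alpha>: "keys \<alpha> \<subseteq> {1..n}" "\<alpha> \<notin> low_exponents n N"
  shows "mmonom \<alpha> c \<in> J"
proof -
  obtain i where i: "lookup \<alpha> i > N"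
    using \<alpha> by (auto simp: low_exponents_def not_le)
  then have "i \<in> keys \<alpha>"
    by (simp add: in_keys_iff)
  then have i_in: "i \<in> {1..n}"
    using \<alpha>(1) by blast
  define \<beta> where "\<beta> = \<alpha> - Poly_Mapping.single i N"
  have \<alpha>_eq: "\<alpha> = \<beta> + Poly_Mapping.single i N"
    unfolding \<beta>_def using i
    by (intro poly_mapping_eqI) (auto simp: lookup_add lookup_minus lookup_single when_def)
  have "keys \<beta> \<subseteq> {1..n}"
    using \<alpha>(1) unfolding \<beta>_def by (auto simp: in_keys_iff lookup_minus)
  then have "mmonom \<beta> c * Y i ^ N \<in> J"
    by (intro ideal_mult[OF J pow[OF i_in]] polys_in_monomial)
  moreover have "mmonom \<beta> c * Y i ^ N = mmonom \<alpha> c"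
    unfolding Y_power mult_single \<alpha>_eq[symmetric] by simp
  ultimately show ?thesis
    by simp
qed

lemma subfield_const: "subfield (range const) (mpoly_ring V :: 'k::field mpoly ring)"
proof -
  let ?R = "mpoly_ring V :: 'k mpoly ring"
  interpret R: cring ?R
    by (rule cring_mpoly_ring)
  show ?thesis
  proof (rule R.subfieldI)
    show "subcring (range const) ?R"
    proof (rule R.subcringI', rule R.subringI)
      show "range const \<subseteq> carrier ?R"
        by auto
      show "\<one>\<^bsub>?R\<^esub> \<in> range const"
        by (auto intro: range_eqI[of _ _ 1])
      fix p :: "'k mpoly" assume "p \<in> range const"
      then obtain c where c: "p = const c"
        by blast
      have "\<ominus>\<^bsub>?R\<^esub> p = const (- c)"
        by (rule R.minus_equality) (simp_all add: c flip: single_add)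
      then show "\<ominus>\<^bsub>?R\<^esub> p \<in> range const"
        by simp
    next
      fix p q :: "'k mpoly" assume "p \<in> range const" "q \<in> range const"
      then obtain a b where "p = const a" "q = const b"
        by blast
      then have "p * q = const (a * b)" "p + q = const (a + b)"
        by (simp_all add: mult_single single_add)
      then show "p \<otimes>\<^bsub>?R\<^esub> q \<in> range const" "p \<oplus>\<^bsub>?R\<^esub> q \<in> range const"
        by simp_all
    qed
    have "p \<in> Units (?R\<lparr>carrier := range const\<rparr>) \<longleftrightarrow> p \<noteq> 0" if p: "p \<in> range const" for p
    proof
      assume "p \<in> Units (?R\<lparr>carrier := range const\<rparr>)"
      then show "p \<noteq> 0"
        by (auto simp: Units_def)
    next
      assume "p \<noteq> 0"
      moreover obtain c where c: "p = const c"
        using p by blast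
      ultimately have "const (1 / c) * p = 1"
        by (auto simp: mult_single)
      then show "p \<in> Units (?R\<lparr>carrier := range const\<rparr>)"
        using p by (auto simp: Units_def mult.commute)
    qed
    then show "Units (?R\<lparr>carrier := range const\<rparr>) = range const - {\<zero>\<^bsub>?R\<^esub>}"
      by (auto simp: Units_def)
  qed
qed

lemma chart_length_eq:
  fixes Z :: "'k::field mpoly set" and n :: nat
  defines "T \<equiv> mpoly_ring {1..n} :: 'k mpoly ring" and "J \<equiv> chart_ideal Z"
  shows "chart_length n Z = ring.dim (T Quot J) ((\<lambda>p. J +>\<^bsub>T\<^esub> p) ` range const) (carrier (T Quot J))"
  by (simp add: chart_length_def T_def J_def Let_def image_image)

text \<open>
  Monomials with a large exponent lie in \<open>J\<close>, so the remaining finitely many span \<open>T/J\<close>.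
\<close>

lemma finite_dimension_chart:
  fixes J :: "'k::field mpoly set" and n :: nat
  defines "T \<equiv> mpoly_ring {1..n} :: 'k mpoly ring"
  assumes J: "ideal J T" and pow: "\<And>i. i \<in> {1..n} \<Longrightarrow> Y i ^ N \<in> J" and "1 \<notin> J"
  shows "ring.finite_dimension (T Quot J) ((\<lambda>p. J +>\<^bsub>T\<^esub> p) ` range const) (carrier (T Quot J))"
proof -
  interpret T: cring T
    unfolding T_def by (rule cring_mpoly_ring)
  have K: "subfield (range const) T"
    unfolding T_def by (rule subfield_const)
  note J' = J[unfolded T_def]
  obtain as where as: "set as = low_exponents n N"
    using finite_list[OF finite_low_exponents] by blast
  define Us where "Us = map (\<lambda>\<alpha>. mmonom \<alpha> (1 :: 'k)) as"
  have Us: "set Us \<subseteq> carrier T"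
    by (auto simp: Us_def as T_def low_exponents_def intro: polys_in_monomial)
  have span_monomial: "mmonom \<alpha> c \<in> T.Span (range const) Us" if "\<alpha> \<in> low_exponents n N" for \<alpha> c
  proof -
    have "mmonom \<alpha> 1 \<in> set Us"
      using that by (auto simp: Us_def as)
    then have "mmonom \<alpha> 1 \<in> T.Span (range const) Us"
      using T.Span_base_incl[OF K Us] by blast
    then have "const c \<otimes>\<^bsub>T\<^esub> mmonom \<alpha> 1 \<in> T.Span (range const) Us"
      by (rule T.Span_smult_closed[OF K Us rangeI])
    then show ?thesis
      unfolding T_def mpoly_ring_simps mult_single by (simp only: add_0 mult_1_right)
  qed
  have span_sum: "(\<Sum>\<alpha>\<in>A. p \<alpha>) \<in> T.Span (range const) Us"
    if "\<And>\<alpha>. \<alpha> \<in> A \<Longrightarrow> p \<alpha> \<in> T.Span (range const) Us" "finite A" for A and p :: "expo \<Rightarrow> 'k mpoly"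
    using that(2,1)
  proof (induction A rule: finite_induct)
    case empty
    have "\<zero>\<^bsub>T\<^esub> \<in> T.Span (range const) Us"
      by (rule T.Span_subgroup_props(2)[OF K Us])
    then show ?case
      unfolding T_def mpoly_ring_simps by (simp only: sum.empty)
  next
    case (insert \<alpha> A)
    have "p \<alpha> \<oplus>\<^bsub>T\<^esub> sum p A \<in> T.Span (range const) Us"
      by (rule T.Span_subgroup_props(3)[OF K Us]) (use insert in blast)+
    then show ?case
      unfolding T_def mpoly_ring_simps by (simp only: sum.insert[OF insert.hyps])
  qed
  show ?thesis
  proof (rule T.finite_dimension_quotient[OF J _ K Us])
    show "\<one>\<^bsub>T\<^esub> \<notin> J"
      using assms(4) by (simp add: T_def)
    fix p assume "p \<in> carrier T"
    then have p: "p \<in> polys_in {1..n}"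
      by (simp add: T_def)
    define t where "t \<alpha> = mmonom \<alpha> (lookup p \<alpha>)" for \<alpha>
    define l where "l = (\<Sum>\<alpha>\<in>keys p \<inter> low_exponents n N. t \<alpha>)"
    define h where "h = (\<Sum>\<alpha>\<in>keys p - low_exponents n N. t \<alpha>)"
    have "p = sum t (keys p)"
      unfolding t_def by (rule sum_monomials)
    also have "\<dots> = h + l"
      unfolding h_def l_def
      by (subst sum.union_disjoint[symmetric]) (auto intro: arg_cong[of _ _ "sum t"])
    finally have p_eq: "p = h + l" .
    have l: "l \<in> T.Span (range const) Us"
      unfolding l_def t_def by (intro span_sum span_monomial) auto
    have "h \<in> J"
      unfolding h_def t_def using p
      by (intro ideal_sum[OF J'] high_monomial_mem[OF J' pow]) (auto simp: polys_in_def)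
    then have "p \<in> J +>\<^bsub>T\<^esub> l"
      unfolding p_eq by (auto simp: a_r_coset_def' T_def)
    moreover have "l \<in> carrier T"
      using l T.Span_subgroup_props(1)[OF K Us] by blast
    ultimately have "J +>\<^bsub>T\<^esub> l = J +>\<^bsub>T\<^esub> p"
      by (rule T.a_repr_independence) (rule additive_subgroup.a_subgroup[OF ideal.axioms(1)[OF J]])
    then show "\<exists>b\<in>T.Span (range const) Us. J +>\<^bsub>T\<^esub> p = J +>\<^bsub>T\<^esub> b"
      using l by (metis (no_types))
  qed
qed

section \<open>Extending linear functionals\<close>

text \<open>
  Let \<open>\<pi>\<close> be a projection onto \<open>J\<close> and \<open>q = id - \<pi>\<close>, whose kernel is \<open>J\<close>.  Let \<open>s\<close> be a linear section of
  \<open>q\<close> over the image of \<open>W\<close>, with values in \<open>W\<close>.  The functional \<open>\<phi> \<circ> s \<circ> q\<close> is zero on \<open>J\<close>.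
  For \<open>x \<in> W\<close> the difference \<open>s (q x) - x\<close> lies in \<open>W\<close> and in the kernel of \<open>q\<close>, so \<open>\<phi>\<close> does not
  see it.
\<close>

lemma (in vector_space) linear_functional_extension:
  assumes \<phi>: "Vector_Spaces.linear scale (*) \<phi>" and J: "subspace J" and W: "subspace W"
    and zero: "\<And>x. x \<in> J \<Longrightarrow> x \<in> W \<Longrightarrow> \<phi> x = 0"
  obtains \<psi> where "Vector_Spaces.linear scale (*) \<psi>" "\<And>x. x \<in> J \<Longrightarrow> \<psi> x = 0"
    "\<And>x. x \<in> W \<Longrightarrow> \<psi> x = \<phi> x"
proof -
  interpret vp: vector_space_pair scale scale
    by unfold_locales
  obtain \<pi> where \<pi>: "range \<pi> \<subseteq> J" "Vector_Spaces.linear scale scale \<pi>" "\<And>v. v \<in> J \<Longrightarrow> \<pi> v = v"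
    using vp.linear_exists_right_inverse_on[OF linear_id J] by auto
  define q where "q x = x - \<pi> x" for x
  have q: "Vector_Spaces.linear scale scale q"
    using vp.linear_compose_sub[OF linear_id \<pi>(2)] by (simp add: q_def[abs_def])
  obtain s where s: "range s \<subseteq> W" "Vector_Spaces.linear scale scale s" "\<And>v. v \<in> q ` W \<Longrightarrow> q (s v) = v"
    using vp.linear_exists_right_inverse_on[OF q W] by auto
  show ?thesis
  proof
    show "Vector_Spaces.linear scale (*) (\<phi> \<circ> (s \<circ> q))"
      by (intro Vector_Spaces.linear_compose[OF _ \<phi>] Vector_Spaces.linear_compose[OF q s(2)])
  next
    fix x assume "x \<in> J"
    then have "q x = 0"
      by (simp add: q_def \<pi>(3))
    then show "(\<phi> \<circ> (s \<circ> q)) x = 0"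
      using module_hom.zero[OF Vector_Spaces.linear.axioms(3)[OF s(2)]] module_hom.zero[OF Vector_Spaces.linear.axioms(3)[OF \<phi>]] by simp
  next
    fix x assume x: "x \<in> W"
    define y where "y = s (q x) - x"
    have "q (s (q x)) = q x"
      using x s(3) by blast
    then have "y = \<pi> (s (q x)) - \<pi> x"
      by (simp add: y_def q_def algebra_simps)
    then have "y \<in> J"
      using \<pi>(1) subspace_diff[OF J] by blast
    moreover have "y \<in> W"
      unfolding y_def using s(1) x by (intro subspace_diff[OF W]) auto
    ultimately have "\<phi> y = 0"
      by (rule zero)
    then show "(\<phi> \<circ> (s \<circ> q)) x = \<phi> x"
      using module_hom.diff[OF Vector_Spaces.linear.axioms(3)[OF \<phi>]] by (simp add: y_def)
  qed
qed

lemma linear_form_const_mult: "linear_form h (const c * p) = c * linear_form h p"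
  by (simp add: linear_form_mult)

lemma vector_space_mpoly: "vector_space (\<lambda>(c :: 'k::field) (p :: 'k mpoly). const c * p)"
  by unfold_locales
    (simp_all add: distrib_left distrib_right single_add mult_single flip: mult.assoc)

lemma vector_space_mult: "vector_space ((*) :: 'k::field \<Rightarrow> 'k \<Rightarrow> 'k)"
  by unfold_locales (simp_all add: algebra_simps)

text \<open>
  Macaulay duality.  Coefficientwise pairing with \<open>f\<close> is a functional on the polynomials of degree at
  most \<open>d\<close> that is zero on those in \<open>J\<close>; extend it to \<open>\<Phi>\<close> with \<open>\<Phi> J = 0\<close>.  All but finitely many monomials
  in \<open>y\<^sub>1,\<dots>,y\<^sub>n\<close> lie in \<open>J\<close>, so the values of \<open>\<Phi>\<close> on monomials form a polynomial \<open>g\<close>.  The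
  coefficient of \<open>x\<^sup>\<gamma>\<close> in \<open>\<psi>(g)\<close> is \<open>\<Phi> (y\<^sup>\<gamma> \<psi>)\<close>, which is zero for \<open>\<psi> \<in> J\<close>.
\<close>

lemma dual_generator_exists:
  fixes J :: "'k::field mpoly set" and f :: "'k mpoly"
  assumes J: "ideal J (mpoly_ring {1..n})" and pow: "\<And>i. i \<in> {1..n} \<Longrightarrow> Y i ^ N \<in> J"
    and f: "f \<in> polys_in {1..n}" "\<And>\<alpha>. \<alpha> \<in> keys f \<Longrightarrow> mdeg \<alpha> \<le> d"
    and zero: "\<And>\<psi>. \<psi> \<in> J \<Longrightarrow> (\<And>\<alpha>. \<alpha> \<in> keys \<psi> \<Longrightarrow> mdeg \<alpha> \<le> d) \<Longrightarrow> linear_form (lookup f) \<psi> = 0"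
  obtains g where "g \<in> polys_in {1..n}" "tail d g = f" "J \<subseteq> perp {1..n} g"
proof -
  interpret V: vector_space "\<lambda>(c :: 'k) (p :: 'k mpoly). const c * p"
    by (rule vector_space_mpoly)
  let ?scale = "\<lambda>(c :: 'k) (p :: 'k mpoly). const c * p"
  let ?W = "{p :: 'k mpoly. \<forall>\<alpha>\<in>keys p. mdeg \<alpha> \<le> d}"
  have "Vector_Spaces.linear ?scale (*) (linear_form (lookup f))"
    unfolding Vector_Spaces.linear_iff
    by (simp add: vector_space_mpoly vector_space_mult linear_form_add linear_form_const_mult)
  moreover have "V.subspace J"
    by (rule V.subspaceI) (auto intro: ideal_zero[OF J] ideal_add[OF J] ideal_mult[OF J])
  moreover have "V.subspace ?W"
  proof (rule V.subspaceI)
    fix p q assume "p \<in> ?W" "q \<in> ?W"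
    then show "p + q \<in> ?W"
      using keys_add[of p q] by blast
  next
    fix c p assume "p \<in> ?W"
    then show "const c * p \<in> ?W"
      using keys_mult[of "const c" p] by (fastforce split: if_splits)
  qed simp
  ultimately obtain \<Phi> where \<Phi>: "Vector_Spaces.linear ?scale (*) \<Phi>" "\<And>p. p \<in> J \<Longrightarrow> \<Phi> p = 0"
    "\<And>p. p \<in> ?W \<Longrightarrow> \<Phi> p = linear_form (lookup f) p"
    by (rule V.linear_functional_extension) (use zero in auto)
  interpret \<Phi>: Vector_Spaces.linear ?scale "(*)" \<Phi>
    by (rule \<Phi>(1))
  define G where "G \<alpha> = (if keys \<alpha> \<subseteq> {1..n} then \<Phi> (mmonom \<alpha> 1) else 0)" for \<alpha>
  have "{\<alpha>. G \<alpha> \<noteq> 0} \<subseteq> low_exponents n N"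
    using high_monomial_mem[OF J pow] \<Phi>(2) by (auto simp: G_def split: if_splits)
  then have "finite {\<alpha>. G \<alpha> \<noteq> 0}"
    using finite_low_exponents finite_subset by blast
  define g where "g = Poly_Mapping.Abs_poly_mapping G"
  have lg: "lookup g \<alpha> = G \<alpha>" for \<alpha>
    unfolding g_def using \<open>finite {\<alpha>. G \<alpha> \<noteq> 0}\<close> by simp
  have \<Phi>_g: "\<Phi> p = linear_form (lookup g) p" if "p \<in> polys_in {1..n}" for p
  proof -
    have "\<Phi> p = (\<Sum>\<alpha>\<in>keys p. \<Phi> (const (lookup p \<alpha>) * mmonom \<alpha> 1))"
      by (subst sum_monomials) (simp add: \<Phi>.sum mult_single)
    also have "\<dots> = (\<Sum>\<alpha>\<in>keys p. lookup p \<alpha> * G \<alpha>)"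
      using that by (intro sum.cong) (auto simp: \<Phi>.scale G_def polys_in_def)
    finally show ?thesis
      by (simp add: linear_form_def lg)
  qed
  show ?thesis
  proof
    show g_in: "g \<in> polys_in {1..n}"
      unfolding polys_in_def
    proof (clarify, rule ccontr)
      fix \<alpha> i assume "\<alpha> \<in> keys g" "i \<in> keys \<alpha>" "i \<notin> {1..n}"
      then have "\<not> keys \<alpha> \<subseteq> {1..n}" "G \<alpha> \<noteq> 0"
        by (blast, simp add: in_keys_iff lg)
      then show False
        by (simp only: G_def if_False simp_thms)
    qed
    show "tail d g = f"
    proof (rule poly_mapping_eqI)
      fix \<alpha>
      have "lookup f \<alpha> = 0" if "\<not> keys \<alpha> \<subseteq> {1..n} \<or> \<not> mdeg \<alpha> \<le> d"
        using that f by (auto simp: polys_in_def in_keys_iff)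
      moreover have "\<Phi> (mmonom \<alpha> 1) = lookup f \<alpha>" if "mdeg \<alpha> \<le> d"
        using \<Phi>(3)[of "mmonom \<alpha> 1"] that by simp
      ultimately show "lookup (tail d g) \<alpha> = lookup f \<alpha>"
        by (auto simp: lookup_tail lg G_def)
    qed
    show "J \<subseteq> perp {1..n} g"
    proof
      fix \<psi> assume \<psi>: "\<psi> \<in> J"
      have "linear_form (\<lambda>\<alpha>. lookup g (\<alpha> + \<gamma>)) \<psi> = 0" for \<gamma>
      \<comment> \<open>If \<open>\<gamma>\<close> involves another variable, \<open>g\<close> has no monomial divisible by \<open>x\<^sup>\<gamma>\<close>.\<close>
      proof (cases "keys \<gamma> \<subseteq> {1..n}")
        case True
        then have "mmonom \<gamma> 1 * \<psi> \<in> J"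
          by (intro ideal_mult[OF J \<psi>] polys_in_monomial)
        then have "linear_form (lookup g) (mmonom \<gamma> 1 * \<psi>) = 0"
          using \<Phi>_g[OF ideal_subset[OF J]] \<Phi>(2) by metis
        then show ?thesis
          by (simp add: linear_form_monomial_mult add.commute)
      next
        case False
        then obtain i where "i \<in> keys \<gamma>" "i \<notin> {1..n}"
          by blast
        then have "i \<in> keys (\<alpha> + \<gamma>)" "i \<notin> {1..n}" for \<alpha>
          by (simp_all add: in_keys_iff lookup_add)
        then have "\<not> keys (\<alpha> + \<gamma>) \<subseteq> {1..n}" for \<alpha>
          by blast
        then have "lookup g (\<alpha> + \<gamma>) = 0" for \<alpha>
          unfolding lg G_def by (simp only: if_False)
        then show ?thesis
          by (intro linear_form_eq_0I)
      qed
      then show "\<psi> \<in> perp {1..n} g"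
        using ideal_subset[OF J \<psi>] by (simp add: perp_iff)
    qed
  qed
qed

section \<open>Minimal local apolar schemes\<close>

theorem proposition4:
  fixes F f :: "'k::alg_closed_field mpoly" and \<Gamma> :: "'k mpoly set" and n d :: nat
  assumes "CHAR('k) \<noteq> 2" and "CHAR('k) \<noteq> 3"
    and "F \<in> carrier (dp_ring {0..n})" and "F \<noteq> 0" and "homogeneous d F"
    and "f = dehom F"
    and "is_arg_min (chart_length n)
           (\<lambda>Z. local_scheme_at n (point_x0 n) Z \<and> apolar n F Z) \<Gamma>"
  shows "\<exists>g \<in> carrier (dp_ring {1..n}). tail d g = f \<and> is_affine_apolar_scheme n \<Gamma> g"
proof -
  let ?T = "mpoly_ring {1..n} :: 'k mpoly ring"
  define J where "J = chart_ideal \<Gamma>"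
  have F_in: "F \<in> polys_in {0..n}"
    using assms(3) by (simp add: dp_ring_def)
  have hom\<Gamma>: "homogeneous_ideal n \<Gamma>" and sat\<Gamma>: "saturated n \<Gamma>" and supp: "support n \<Gamma> = {point_x0 n}"
    and apo: "\<Gamma> \<subseteq> perp {0..n} F"
    and minimal: "\<And>Z. local_scheme_at n (point_x0 n) Z \<Longrightarrow> apolar n F Z
       \<Longrightarrow> \<not> chart_length n Z < chart_length n \<Gamma>"
    using assms(7)
    by (auto simp: is_arg_min_def local_scheme_at_def closed_subscheme_def apolar_def)
  have "point_x0 n \<in> support n \<Gamma>"
    using supp by blast
  then have pt: "point_x0 n \<in> (proj_points n :: 'k mpoly set set)"
    by (simp add: support_def)
  note \<Gamma>' = homogeneous_idealD(1)[OF hom\<Gamma>]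
  have J: "ideal J ?T"
    unfolding J_def by (rule ideal_chart_ideal[OF \<Gamma>'])

  obtain N where N: "\<And>i. i \<in> {1..n} \<Longrightarrow> (Y i :: 'k mpoly) ^ N \<in> \<Gamma>"
    using nilpotent_of_support[OF hom\<Gamma> supp] by blast
  have NJ: "(Y i :: 'k mpoly) ^ N \<in> J" if "i \<in> {1..n}" for i
    unfolding J_def by (rule chart_power_mem[OF that N[OF that]])

  have satY0: "p \<in> \<Gamma>" if "p \<in> polys_in {0..n}" "Y 0 ^ k * p \<in> \<Gamma>" for p k
    using saturated_cancel_Y0[OF \<Gamma>' sat\<Gamma> N that] .

  have f_in: "f \<in> polys_in {1..n}"
    unfolding assms(6) by (rule dehom_in[OF F_in])
  obtain g where g: "g \<in> polys_in {1..n}" "tail d g = f" "J \<subseteq> perp {1..n} g"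
  proof (rule dual_generator_exists[OF J NJ f_in])
    show "mdeg \<alpha> \<le> d" if "\<alpha> \<in> keys f" for \<alpha>
      using that unfolding assms(6) by (rule mdeg_dehom_le[OF assms(5)])
    show "linear_form (lookup f) \<psi> = 0"
      if \<psi>: "\<psi> \<in> J" and deg: "\<And>\<alpha>. \<alpha> \<in> keys \<psi> \<Longrightarrow> mdeg \<alpha> \<le> d" for \<psi>
    proof -
      have "homogenize d \<psi> \<in> \<Gamma>"
        by (rule homogenize_mem[OF hom\<Gamma> satY0 \<psi>[unfolded J_def] deg])
      then show ?thesis
        unfolding assms(6) using apo
        by (intro apolar_chart_linear_form[OF assms(5) ideal_subset[OF J \<psi>] deg]) auto
    qed
  qed

  have "g \<noteq> 0"
  proof
    assume "g = 0"
    then have "tail d g = 0"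
      by (intro poly_mapping_eqI) (simp add: lookup_tail)
    then have "dehom F = 0"
      using g(2) assms(6) by simp
    then have "F = 0"
      using homogenize_dehom[OF assms(5)] by (simp add: homogenize_def)
    then show False
      using assms(4) by blast
  qed
  define J' where "J' = perp {1..n} g"
  have J': "ideal J' ?T"
    unfolding J'_def by (rule ideal_perp)
  define \<Gamma>g where "\<Gamma>g = projective_closure n J'"
  have "support n \<Gamma>g = {point_x0 n}"
  proof (rule support_eq_point[OF _ pt])
    show "\<Gamma>g \<subseteq> point_x0 n"
      unfolding \<Gamma>g_def J'_def by (rule projective_closure_perp_subset_point[OF \<open>g \<noteq> 0\<close>])
    show "\<exists>k. Y i ^ k \<in> \<Gamma>g" if "i \<in> {1..n}" for i
      using Y_power_in_projective_closure[OF J' that] NJ[OF that] g(3) unfolding \<Gamma>g_def J'_def by blast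
  qed
  moreover have "closed_subscheme n \<Gamma>g"
    unfolding closed_subscheme_def \<Gamma>g_def
    using homogeneous_ideal_projective_closure[OF J'] saturated_projective_closure by blast
  ultimately have "local_scheme_at n (point_x0 n) \<Gamma>g"
    by (simp add: local_scheme_at_def zero_dimensional_def)
  moreover have "apolar n F \<Gamma>g"
    unfolding apolar_def \<Gamma>g_def J'_def
    by (rule projective_closure_perp_apolar[OF assms(5)]) (simp add: g(2) assms(6))
  ultimately have not_less: "\<not> chart_length n \<Gamma>g < chart_length n \<Gamma>"
    by (rule minimal)
  have "1 \<notin> J'"
    using perp_constant_term[OF \<open>g \<noteq> 0\<close>, of 1 "{1..n}"] unfolding J'_def by auto
  have "J = J'"
  proof (rule ccontr)
    assume "J \<noteq> J'"
    then have "J \<subset> J'"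
      using g(3) unfolding J'_def by blast
    interpret T: cring ?T
      by (rule cring_mpoly_ring)
    have "chart_length n \<Gamma>g < chart_length n \<Gamma>"
      unfolding chart_length_eq J_def[symmetric] \<Gamma>g_def chart_ideal_projective_closure[OF J']
    proof (rule T.dim_quotient_less[OF J J' \<open>J \<subset> J'\<close> _ subfield_const])
      show "\<one>\<^bsub>?T\<^esub> \<notin> J'"
        using \<open>1 \<notin> J'\<close> by simp
      show "ring.finite_dimension (?T Quot J) ((\<lambda>p. J +>\<^bsub>?T\<^esub> p) ` range const) (carrier (?T Quot J))"
        by (rule finite_dimension_chart[OF J NJ]) (use \<open>1 \<notin> J'\<close> \<open>J \<subset> J'\<close> in auto)
    qed
    then show False
      using not_less by blast
  qed
  moreover have "in_chart n \<Gamma>"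
    unfolding in_chart_def supp using Y0_notin_point_x0[OF pt] by blast
  ultimately have "is_affine_apolar_scheme n \<Gamma> g"
    by (simp add: is_affine_apolar_scheme_def J_def J'_def)
  moreover have "g \<in> carrier (dp_ring {1..n})"
    using g(1) by (simp add: dp_ring_def)
  ultimately show ?thesis
    using g(2) by blast
qed

end
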